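(* Assume Schanuel's conjecture holds. Let $\xi\in\mathbb C^*$, and let $h$ be an irreducible exponential polynomial over $\overline{\mathbb Q}$ with $h(\xi)=0$. Then for every exponential polynomial $f$ over $\overline{\mathbb Q}$ with $f(\xi)=0$, the function $f/h$ is an exponential polynomial over $\overline{\mathbb Q}$.
   Context: An exponential polynomial over $\overline{\mathbb Q}$ is a function $f(x)=\sum_{i=1}^N P_i(x)e^{\beta_i x}$ with $N\ge1$, $P_i\in\overline{\mathbb Q}[X]$, $\beta_i\in\overline{\mathbb Q}$. These form a ring $\mathcal P$ whose units are the functions $\lambda e^{\alpha x}$ with $\lambda,\alpha\in\overline{\mathbb Q}$, $\lambda\neq0$. An element of $\mathcal P$ is irreducible if it is not a unit and cannot be written as a product of two non-units of $\mathcal P$. Schanuel's conjecture: if $x_1,\dots,x_n\in\mathbb C$ are linearly independent over $\mathbb Q$, then $\overline{\mathbb Q}(x_1,\dots,x_n,e^{x_1},\dots,e^{x_n})$ has transcendence degree at least $n$ over $\overline{\mathbb Q}$. *)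

theory Defs
  imports
    Complex_Main
    "HOL-Computational_Algebra.Polynomial"
    "HOL-Library.Poly_Mapping"
    "HOL-Library.Extended_Nat"
begin

global_interpretation rat_vs: vector_space "\<lambda>(q::rat) (z::complex). of_rat q * z"
  by unfold_locales (simp_all add: algebra_simps of_rat_add of_rat_mult)

section \<open>The algebraic numbers form a field\<close>

lemma algebraic_if_fin_span:
  fixes z :: complex
  assumes A: "finite A" and one: "1 \<in> rat_vs.span A"
    and closed: "\<And>a. a \<in> A \<Longrightarrow> z * a \<in> rat_vs.span A"
  shows "algebraic z"
proof -
  have cl: "z * v \<in> rat_vs.span A" if "v \<in> rat_vs.span A" for v
    using that
  proof (induction rule: rat_vs.span_induct_alt)
    case base
    show ?case by (simp add: rat_vs.span_zero)
  next
    case (step c x y)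
    have "z * (of_rat c * x + y) = of_rat c * (z * x) + z * y"
      by (simp add: algebra_simps)
    with step closed[of x] show ?case
      by (simp add: rat_vs.span_add rat_vs.span_scale)
  qed
  have pow: "z ^ k \<in> rat_vs.span A" for k
    by (induction k) (use one cl in auto)
  define n where "n = card A"
  show ?thesis
  proof (cases "inj_on (\<lambda>k. z ^ k) {..n}")
    case False
    then obtain i j where ij: "i \<noteq> j" "z ^ i = z ^ j"
      by (auto simp: inj_on_def)
    define p :: "complex poly" where "p = monom 1 i - monom 1 j"
    have "coeff p i = 1" using ij by (simp add: p_def)
    hence "p \<noteq> 0" by auto
    moreover have "poly p z = 0" using ij by (simp add: p_def poly_monom)
    moreover have "coeff p k \<in> \<int>" for k by (simp add: p_def)
    ultimately show ?thesis by (intro algebraicI)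
  next
    case True
    let ?S = "(\<lambda>k. z ^ k) ` {..n}"
    have "card ?S = Suc n" using True by (simp add: card_image)
    moreover have "?S \<subseteq> rat_vs.span A" using pow by auto
    ultimately have "rat_vs.dependent ?S"
      using rat_vs.independent_span_bound[OF A, of ?S] n_def by auto
    then obtain u where u: "\<exists>v\<in>?S. u v \<noteq> 0" "(\<Sum>v\<in>?S. of_rat (u v) * v) = 0"
      by (subst (asm) rat_vs.dependent_finite) auto
    define p :: "complex poly" where "p = (\<Sum>k\<le>n. monom (of_rat (u (z ^ k))) k)"
    have cf: "coeff p k = (if k \<le> n then of_rat (u (z ^ k)) else 0)" for k
      by (simp add: p_def coeff_sum)
    have "p \<noteq> 0" using u(1) cf by (metis (no_types, lifting) atMost_iff coeff_0 imageE of_rat_eq_0_iff)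
    moreover have "poly p z = 0"
      using u(2) True by (simp add: p_def poly_sum poly_monom sum.reindex)
    moreover have "coeff p k \<in> \<rat>" for k by (simp add: cf)
    ultimately show ?thesis by (intro algebraicI')
  qed
qed

lemma algebraic_power_span:
  fixes x :: complex
  assumes "algebraic x"
  obtains n where "n > 0" "x ^ n \<in> rat_vs.span ((\<lambda>k. x ^ k) ` {..<n})"
proof -
  from assms obtain p where p: "\<And>i. coeff p i \<in> \<rat>" "p \<noteq> 0" "poly p x = 0"
    unfolding algebraic_altdef by blast
  define n where "n = degree p"
  have "n > 0"
  proof (rule ccontr)
    assume "\<not> n > 0"
    then obtain c where "p = [:c:]" by (auto simp: n_def elim: degree_eq_zeroE)
    with p show False by auto
  qed
  have lc: "coeff p n \<noteq> 0" using p by (simp add: n_def)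
  have "(\<Sum>k\<le>n. coeff p k * x ^ k) = 0"
    using p(3) by (simp add: poly_altdef n_def)
  hence "coeff p n * x ^ n = - (\<Sum>k<n. coeff p k * x ^ k)"
    by (simp add: lessThan_Suc_atMost[symmetric] add_eq_0_iff2 add.commute add_eq_0_iff)
  hence eq: "x ^ n = (\<Sum>k<n. (- (coeff p k / coeff p n)) * x ^ k)"
    using lc by (simp add: field_simps sum_negf sum_divide_distrib[symmetric])
  have "(- (coeff p k / coeff p n)) * x ^ k \<in> rat_vs.span ((\<lambda>k. x ^ k) ` {..<n})" if "k < n" for k
  proof -
    have "- (coeff p k / coeff p n) \<in> \<rat>" using p(1) by simp
    then obtain q where "- (coeff p k / coeff p n) = of_rat q" by (rule Rats_cases)
    moreover have "of_rat q * x ^ k \<in> rat_vs.span ((\<lambda>k. x ^ k) ` {..<n})"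
      using that by (intro rat_vs.span_scale rat_vs.span_base) auto
    ultimately show ?thesis by simp
  qed
  hence "x ^ n \<in> rat_vs.span ((\<lambda>k. x ^ k) ` {..<n})"
    unfolding eq by (intro rat_vs.span_sum) auto
  with \<open>n > 0\<close> show ?thesis by (rule that)
qed

lemma
  fixes x y :: complex
  assumes x: "algebraic x" and y: "algebraic y"
  shows algebraic_add: "algebraic (x + y)"
    and algebraic_mult: "algebraic (x * y)"
proof -
  from x obtain m where m: "m > 0" "x ^ m \<in> rat_vs.span ((\<lambda>k. x ^ k) ` {..<m})"
    by (rule algebraic_power_span)
  from y obtain n where n: "n > 0" "y ^ n \<in> rat_vs.span ((\<lambda>k. y ^ k) ` {..<n})"
    by (rule algebraic_power_span)
  define A where "A = (\<lambda>(i,j). x ^ i * y ^ j) ` ({..<m} \<times> {..<n})"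
  have fin: "finite A" by (simp add: A_def)
  have base: "x ^ i * y ^ j \<in> rat_vs.span A" if "i < m" "j < n" for i j
    using that by (intro rat_vs.span_base) (auto simp: A_def)
  have one: "1 \<in> rat_vs.span A" using base[of 0 0] m n by simp
  have *: "v * y ^ j \<in> rat_vs.span A" if "v \<in> rat_vs.span ((\<lambda>k. x ^ k) ` {..<m})" "j < n" for v j
    using that(1)
  proof (induction rule: rat_vs.span_induct_alt)
    case (step c a b)
    then have "a * y ^ j \<in> rat_vs.span A" using base that(2) by auto
    moreover have "(of_rat c * a + b) * y ^ j = of_rat c * (a * y ^ j) + b * y ^ j"
      by (simp add: algebra_simps)
    ultimately show ?case using step by (simp add: rat_vs.span_add rat_vs.span_scale)
  qed (simp add: rat_vs.span_zero)
  have **: "x ^ i * v \<in> rat_vs.span A" if "v \<in> rat_vs.span ((\<lambda>k. y ^ k) ` {..<n})" "i < m" for v i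
    using that(1)
  proof (induction rule: rat_vs.span_induct_alt)
    case (step c a b)
    then have "x ^ i * a \<in> rat_vs.span A" using base that(2) by auto
    moreover have "x ^ i * (of_rat c * a + b) = of_rat c * (x ^ i * a) + x ^ i * b"
      by (simp add: algebra_simps)
    ultimately show ?case using step by (simp add: rat_vs.span_add rat_vs.span_scale)
  qed (simp add: rat_vs.span_zero)
  have X: "x * a \<in> rat_vs.span A" if "a \<in> A" for a
  proof -
    from that obtain i j where ij: "a = x ^ i * y ^ j" "i < m" "j < n" by (auto simp: A_def)
    have "x ^ Suc i * y ^ j \<in> rat_vs.span A"
    proof (cases "Suc i = m")
      case True
      show ?thesis unfolding True by (rule *[OF m(2) ij(3)])
    next
      case False
      with ij show ?thesis by (intro base) auto
    qed
    thus ?thesis by (simp add: ij mult.assoc)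
  qed
  have Y: "y * a \<in> rat_vs.span A" if "a \<in> A" for a
  proof -
    from that obtain i j where ij: "a = x ^ i * y ^ j" "i < m" "j < n" by (auto simp: A_def)
    have "x ^ i * y ^ Suc j \<in> rat_vs.span A"
    proof (cases "Suc j = n")
      case True
      show ?thesis unfolding True by (rule **[OF n(2) ij(2)])
    next
      case False
      with ij show ?thesis by (intro base) auto
    qed
    thus ?thesis by (simp add: ij mult_ac)
  qed
  have Xs: "x * v \<in> rat_vs.span A" if "v \<in> rat_vs.span A" for v
    using that
  proof (induction rule: rat_vs.span_induct_alt)
    case (step c a b)
    moreover have "x * (of_rat c * a + b) = of_rat c * (x * a) + x * b"
      by (simp add: algebra_simps)
    ultimately show ?case using X[of a] by (simp add: rat_vs.span_add rat_vs.span_scale)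
  qed (simp add: rat_vs.span_zero)
  show "algebraic (x + y)"
    by (rule algebraic_if_fin_span[OF fin one])
      (simp add: distrib_right rat_vs.span_add X Y)
  show "algebraic (x * y)"
    by (rule algebraic_if_fin_span[OF fin one])
      (simp add: mult.assoc Xs Y)
qed

lemma algebraic_sum:
  fixes f :: "'a \<Rightarrow> complex"
  shows "(\<And>i. i \<in> I \<Longrightarrow> algebraic (f i)) \<Longrightarrow> algebraic (\<Sum>i\<in>I. f i)"
  by (induction I rule: infinite_finite_induct) (auto intro: algebraic_add)

section \<open>The ring of exponential polynomials over the algebraic numbers\<close>

definition is_exp_poly :: "(complex \<Rightarrow> complex) \<Rightarrow> bool" where
  "is_exp_poly f \<longleftrightarrow>
     (\<exists>(N::nat) (P :: nat \<Rightarrow> complex poly) (\<beta> :: nat \<Rightarrow> complex). N \<ge> 1 \<and>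
        (\<forall>i\<in>{1..N}. (\<forall>k. algebraic (coeff (P i) k)) \<and> algebraic (\<beta> i)) \<and>
        (\<forall>x. f x = (\<Sum>i=1..N. poly (P i) x * exp (\<beta> i * x))))"

lemma is_exp_polyI:
  fixes P :: "'i \<Rightarrow> complex poly"
  assumes "finite I"
    and "\<And>i k. i \<in> I \<Longrightarrow> algebraic (coeff (P i) k)" "\<And>i. i \<in> I \<Longrightarrow> algebraic (\<beta> i)"
    and f: "\<And>x. f x = (\<Sum>i\<in>I. poly (P i) x * exp (\<beta> i * x))"
  shows "is_exp_poly f"
proof (cases "I = {}")
  case True
  show ?thesis unfolding is_exp_poly_def
    by (rule exI[of _ 1], rule exI[of _ "\<lambda>_. 0"], rule exI[of _ "\<lambda>_. 0"]) (simp add: f True)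
next
  case False
  obtain g where g: "bij_betw g {1..card I} I"
    using ex_bij_betw_nat_finite_1[OF assms(1)] by auto
  have mem: "g i \<in> I" if "i \<in> {1..card I}" for i
    using g that by (auto simp: bij_betw_def)
  have "f x = (\<Sum>i=1..card I. poly (P (g i)) x * exp (\<beta> (g i) * x))" for x
    unfolding f by (rule sum.reindex_bij_betw[OF g, symmetric])
  moreover have "card I \<ge> 1" using False assms(1) by (simp add: Suc_le_eq card_gt_0_iff)
  ultimately show ?thesis unfolding is_exp_poly_def
    using assms mem by (intro exI[of _ "card I"] exI[of _ "P \<circ> g"] exI[of _ "\<beta> \<circ> g"]) auto
qed

lemma is_exp_poly_const: "algebraic c \<Longrightarrow> is_exp_poly (\<lambda>_. c)"
  by (rule is_exp_polyI[of "{()}" "\<lambda>_. [:c:]" "\<lambda>_. 0"]) (auto simp: coeff_pCons split: nat.splits)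

lemma is_exp_poly_add:
  assumes "is_exp_poly f" "is_exp_poly g"
  shows "is_exp_poly (\<lambda>x. f x + g x)"
proof -
  from assms(1) obtain N P \<beta> where 1:
    "\<And>i. i \<in> {1..N::nat} \<Longrightarrow> (\<forall>k. algebraic (coeff (P i) k)) \<and> algebraic (\<beta> i)"
    "\<And>x. f x = (\<Sum>i=1..N. poly (P i) x * exp (\<beta> i * x))"
    unfolding is_exp_poly_def by blast
  from assms(2) obtain M Q \<gamma> where 2:
    "\<And>i. i \<in> {1..M::nat} \<Longrightarrow> (\<forall>k. algebraic (coeff (Q i) k)) \<and> algebraic (\<gamma> i)"
    "\<And>x. g x = (\<Sum>i=1..M. poly (Q i) x * exp (\<gamma> i * x))"
    unfolding is_exp_poly_def by blast
  show ?thesis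
    by (rule is_exp_polyI[of "{1..N} <+> {1..M}" "case_sum P Q" "case_sum \<beta> \<gamma>"])
      (use 1 2 in \<open>auto simp: sum.Plus\<close>)
qed

lemma is_exp_poly_mult:
  assumes "is_exp_poly f" "is_exp_poly g"
  shows "is_exp_poly (\<lambda>x. f x * g x)"
proof -
  from assms(1) obtain N P \<beta> where 1:
    "\<And>i. i \<in> {1..N::nat} \<Longrightarrow> (\<forall>k. algebraic (coeff (P i) k)) \<and> algebraic (\<beta> i)"
    "\<And>x. f x = (\<Sum>i=1..N. poly (P i) x * exp (\<beta> i * x))"
    unfolding is_exp_poly_def by blast
  from assms(2) obtain M Q \<gamma> where 2:
    "\<And>i. i \<in> {1..M::nat} \<Longrightarrow> (\<forall>k. algebraic (coeff (Q i) k)) \<and> algebraic (\<gamma> i)"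
    "\<And>x. g x = (\<Sum>i=1..M. poly (Q i) x * exp (\<gamma> i * x))"
    unfolding is_exp_poly_def by blast
  have eq: "f x * g x = (\<Sum>(i,j)\<in>{1..N}\<times>{1..M}. poly (P i * Q j) x * exp ((\<beta> i + \<gamma> j) * x))" for x
    unfolding 1(2) 2(2) sum_product sum.cartesian_product
    by (intro sum.cong) (auto simp: exp_add algebra_simps)
  show ?thesis
    by (rule is_exp_polyI[of "{1..N}\<times>{1..M}" "\<lambda>(i,j). P i * Q j" "\<lambda>(i,j). \<beta> i + \<gamma> j"])
      (use 1(1) 2(1) in \<open>auto simp: eq coeff_mult case_prod_beta
         intro!: algebraic_add algebraic_mult algebraic_sum\<close>)
qed

lemma is_exp_poly_uminus: "is_exp_poly f \<Longrightarrow> is_exp_poly (\<lambda>x. - f x)"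
  using is_exp_poly_mult[OF is_exp_poly_const[of "- 1"], of f] by simp

lemma is_exp_poly_diff: "is_exp_poly f \<Longrightarrow> is_exp_poly g \<Longrightarrow> is_exp_poly (\<lambda>x. f x - g x)"
  using is_exp_poly_add[OF _ is_exp_poly_uminus] by simp

typedef exp_poly = "{f. is_exp_poly f}" morphisms exp_eval Abs_exp_poly
  using is_exp_poly_const[of 0] by auto

setup_lifting type_definition_exp_poly

instantiation exp_poly :: comm_ring_1
begin

lift_definition zero_exp_poly :: exp_poly is "\<lambda>_. 0"
  by (rule is_exp_poly_const) simp

lift_definition one_exp_poly :: exp_poly is "\<lambda>_. 1"
  by (rule is_exp_poly_const) simp

lift_definition plus_exp_poly :: "exp_poly \<Rightarrow> exp_poly \<Rightarrow> exp_poly" is "\<lambda>f g x. f x + g x"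
  by (rule is_exp_poly_add)

lift_definition minus_exp_poly :: "exp_poly \<Rightarrow> exp_poly \<Rightarrow> exp_poly" is "\<lambda>f g x. f x - g x"
  by (rule is_exp_poly_diff)

lift_definition uminus_exp_poly :: "exp_poly \<Rightarrow> exp_poly" is "\<lambda>f x. - f x"
  by (rule is_exp_poly_uminus)

lift_definition times_exp_poly :: "exp_poly \<Rightarrow> exp_poly \<Rightarrow> exp_poly" is "\<lambda>f g x. f x * g x"
  by (rule is_exp_poly_mult)

instance
  by standard (transfer; simp add: fun_eq_iff algebra_simps)+

end

section \<open>Transcendence degree and Schanuel's conjecture\<close>

definition is_subfield :: "'a::field set \<Rightarrow> bool" where
  "is_subfield K \<longleftrightarrow> 0 \<in> K \<and> 1 \<in> K \<and>
     (\<forall>x\<in>K. \<forall>y\<in>K. x + y \<in> K \<and> x * y \<in> K) \<and> (\<forall>x\<in>K. - x \<in> K \<and> inverse x \<in> K)"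

definition field_adjoin :: "'a::field set \<Rightarrow> 'a set \<Rightarrow> 'a set" where
  "field_adjoin K S = is_subfield hull (K \<union> S)"

text \<open>A multivariate polynomial is a finitely supported map from monomials to coefficients,
  a monomial being a finitely supported map from variables to exponents.\<close>

definition mpoly_eval :: "('v \<Rightarrow> 'a::comm_semiring_1) \<Rightarrow> (('v \<Rightarrow>\<^sub>0 nat) \<Rightarrow>\<^sub>0 'a) \<Rightarrow> 'a" where
  "mpoly_eval a p =
     (\<Sum>m\<in>Poly_Mapping.keys p. Poly_Mapping.lookup p m *
        (\<Prod>v\<in>Poly_Mapping.keys m. a v ^ Poly_Mapping.lookup m v))"

text \<open>The elements of \<open>B\<close> themselves serve as the names of the variables.\<close>

definition alg_independent :: "'a::field set \<Rightarrow> 'a set \<Rightarrow> bool" where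
  "alg_independent K B \<longleftrightarrow>
     (\<forall>p :: ('a \<Rightarrow>\<^sub>0 nat) \<Rightarrow>\<^sub>0 'a.
        (\<forall>m. Poly_Mapping.lookup p m \<in> K) \<and> (\<forall>m\<in>Poly_Mapping.keys p. Poly_Mapping.keys m \<subseteq> B) \<and>
        mpoly_eval (\<lambda>v. v) p = 0 \<longrightarrow> p = 0)"

definition trdeg :: "'a::field set \<Rightarrow> 'a set \<Rightarrow> enat" where
  "trdeg K L = (SUP B\<in>{B. finite B \<and> B \<subseteq> L \<and> alg_independent K B}. enat (card B))"

definition Qbar :: "complex set" where
  "Qbar = {z. algebraic z}"

text \<open>Linear independence of a tuple means that its entries are distinct and form an
  independent set.\<close>

definition schanuel_conjecture :: bool where
  "schanuel_conjecture \<longleftrightarrow>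
     (\<forall>(n::nat) (x :: nat \<Rightarrow> complex).
        inj_on x {1..n} \<and> rat_vs.independent (x ` {1..n}) \<longrightarrow>
        enat n \<le> trdeg Qbar (field_adjoin Qbar (x ` {1..n} \<union> (\<lambda>i. exp (x i)) ` {1..n})))"

end

theory Submission
  imports Defs
begin

text \<open>Choose algebraic numbers \<open>\<beta>\<^sub>1, \<dots>, \<beta>\<^sub>n\<close>, linearly independent over the rationals, such that
  all exponents of \<open>f\<close> and \<open>h\<close> are integer combinations of them. Up to a unit, \<open>f\<close> and \<open>h\<close> are
  then polynomials in the \<open>n + 1\<close> functions \<open>x, exp (\<beta>\<^sub>i x)\<close>. By Schanuel's conjecture and the exchange
  property of algebraic dependence, the values at \<open>\<xi>\<close> of \<open>n\<close> of these functions are algebraically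
  independent. Hence evaluation at \<open>\<xi>\<close> is injective on the ring \<open>C\<close> generated by these \<open>n\<close> functions,
  and its image is a factorial ring \<open>A\<close>. The polynomials over \<open>A\<close> that vanish at the value of the
  remaining function form a principal ideal: it is generated by a prime factor of an element of
  minimal degree, as pseudo-division shows. Lifted back through \<open>C\<close>, its generator is an exponential
  polynomial \<open>g\<close> that vanishes at \<open>\<xi>\<close> and divides both \<open>h\<close> and \<open>f\<close>. Since \<open>h\<close> is irreducible and
  \<open>g\<close> is not a unit, \<open>h\<close> is associated to \<open>g\<close>, so it divides \<open>f\<close>.\<close>

section \<open>Subrings and adjunction of an element\<close>

text \<open>The full ring is out of reach of factorization theory: \<open>exp x - 1\<close> splits
  as \<open>(exp (x/2) - 1) * (exp (x/2) + 1)\<close>, and so on without end. Therefore a finitely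
  generated subring is built for the given pair \<open>f\<close>, \<open>h\<close>, and
  \<open>g\<close> is only required to divide both; the irreducibility of \<open>h\<close> is used
  at the very end, in the full ring. Schanuel's conjecture is applied to the numbers
  \<open>\<beta> i * \<xi>\<close>, which are independent because \<open>\<xi> \<noteq> 0\<close>.
  Since the \<open>\<beta> i\<close> are algebraic, the field in question is algebraic over the n +
  1 values \<open>\<xi>\<close>, \<open>exp (\<beta> i * \<xi>)\<close>. Setting aside n independent
  ones leaves a single value, so the relations at \<open>\<xi>\<close> become polynomials in one
  variable. Over the fraction field of \<open>A\<close> such polynomials form a principal ideal at
  once, but division by a generator leaves denominators from \<open>A\<close>, and these lift to
  functions that may have zeros. Factoriality of \<open>A\<close>, through Gauss's lemma, is what
  removes the denominators.\<close>

definition is_subring :: "'a::comm_ring_1 set \<Rightarrow> bool" where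
  "is_subring A \<longleftrightarrow> 0 \<in> A \<and> 1 \<in> A \<and> (\<forall>x\<in>A. \<forall>y\<in>A. x + y \<in> A \<and> x * y \<in> A) \<and> (\<forall>x\<in>A. - x \<in> A)"

lemma is_subringD:
  assumes "is_subring A"
  shows "0 \<in> A" "1 \<in> A" "x \<in> A \<Longrightarrow> y \<in> A \<Longrightarrow> x + y \<in> A" "x \<in> A \<Longrightarrow> y \<in> A \<Longrightarrow> x * y \<in> A"
    "x \<in> A \<Longrightarrow> - x \<in> A" "x \<in> A \<Longrightarrow> y \<in> A \<Longrightarrow> x - y \<in> A"
proof -
  show "x \<in> A \<Longrightarrow> y \<in> A \<Longrightarrow> x - y \<in> A"
    using assms unfolding is_subring_def by (metis add_uminus_conv_diff)
qed (use assms in \<open>auto simp: is_subring_def\<close>)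

lemma is_subring_sum: "is_subring A \<Longrightarrow> (\<And>i. i \<in> I \<Longrightarrow> f i \<in> A) \<Longrightarrow> sum f I \<in> A"
  by (induction I rule: infinite_finite_induct) (auto simp: is_subringD)

lemma is_subring_prod: "is_subring A \<Longrightarrow> (\<And>i. i \<in> I \<Longrightarrow> f i \<in> A) \<Longrightarrow> prod f I \<in> A"
  by (induction I rule: infinite_finite_induct) (auto simp: is_subringD)

lemma is_subring_prod_list: "is_subring A \<Longrightarrow> set xs \<subseteq> A \<Longrightarrow> prod_list xs \<in> A"
  by (induction xs) (auto simp: is_subringD)

lemma is_subring_power: "is_subring A \<Longrightarrow> x \<in> A \<Longrightarrow> x ^ n \<in> A"
  by (induction n) (auto simp: is_subringD)

definition polys_over :: "'a::comm_ring_1 set \<Rightarrow> 'a poly set" where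
  "polys_over A = {p. \<forall>i. coeff p i \<in> A}"

lemma is_subring_polys_over: "is_subring A \<Longrightarrow> is_subring (polys_over A)"
  by (subst is_subring_def) (auto simp: polys_over_def is_subringD coeff_mult coeff_1 intro!: is_subring_sum)

lemma polys_over_mono: "A \<subseteq> B \<Longrightarrow> polys_over A \<subseteq> polys_over B"
  by (auto simp: polys_over_def)

lemma monom_in_polys_over: "is_subring A \<Longrightarrow> a \<in> A \<Longrightarrow> monom a n \<in> polys_over A"
  by (auto simp: polys_over_def is_subringD)

lemma const_in_polys_over: "is_subring A \<Longrightarrow> a \<in> A \<Longrightarrow> [:a:] \<in> polys_over A"
  using monom_in_polys_over[of A a 0] by (simp add: monom_0)

lemma smult_in_polys_over: "is_subring A \<Longrightarrow> a \<in> A \<Longrightarrow> p \<in> polys_over A \<Longrightarrow> smult a p \<in> polys_over A"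
  by (auto simp: polys_over_def is_subringD)

lemma pCons_in_polys_over_iff: "pCons a p \<in> polys_over A \<longleftrightarrow> a \<in> A \<and> p \<in> polys_over A"
  by (auto simp: polys_over_def coeff_pCons split: nat.splits)

lemma poly_in_subring: "is_subring A \<Longrightarrow> p \<in> polys_over A \<Longrightarrow> x \<in> A \<Longrightarrow> poly p x \<in> A"
  unfolding poly_altdef by (intro is_subring_sum) (auto simp: polys_over_def is_subringD is_subring_power)

definition adjoin :: "'a::comm_ring_1 set \<Rightarrow> 'a \<Rightarrow> 'a set" where
  "adjoin A t = (\<lambda>p. poly p t) ` polys_over A"

text \<open>The homomorphism laws are assumed on \<open>S\<close> only, because
  \<open>ep_const\<close> satisfies them only on the algebraic numbers.\<close>

lemma is_subring_image:
  assumes "is_subring S" "f 0 = 0" "f 1 = 1" "\<And>x y. x \<in> S \<Longrightarrow> y \<in> S \<Longrightarrow> f (x + y) = f x + f y"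
    "\<And>x y. x \<in> S \<Longrightarrow> y \<in> S \<Longrightarrow> f (x * y) = f x * f y"
  shows "is_subring (f ` S)"
proof -
  have neg: "f (- x) = - f x" if "x \<in> S" for x
    using assms(4)[of x "- x"] assms(1,2) that
    by (simp add: is_subringD eq_neg_iff_add_eq_0 add.commute)
  show ?thesis unfolding is_subring_def
  proof (intro conjI ballI)
    show "0 \<in> f ` S" "1 \<in> f ` S"
      using assms(2,3) is_subringD(1,2)[OF assms(1)] by (metis imageI)+
    fix x assume "x \<in> f ` S"
    then obtain a where a: "a \<in> S" "x = f a" by blast
    then show "- x \<in> f ` S" using is_subringD(5)[OF assms(1)] by (simp flip: neg)
    fix y assume "y \<in> f ` S"
    then obtain b where b: "b \<in> S" "y = f b" by blast
    then show "x + y \<in> f ` S" "x * y \<in> f ` S"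
      using a assms(4,5)[of a b, symmetric] is_subringD(3,4)[OF assms(1)] by simp_all
  qed
qed

lemma is_subring_adjoin: "is_subring A \<Longrightarrow> is_subring (adjoin A t)"
  unfolding adjoin_def by (rule is_subring_image) (auto simp: is_subring_polys_over)

lemma subset_adjoin: "is_subring A \<Longrightarrow> A \<subseteq> adjoin A t"
proof
  fix x assume "is_subring A" "x \<in> A"
  then show "x \<in> adjoin A t"
    unfolding adjoin_def by (intro image_eqI[of _ _ "[:x:]"]) (auto simp: const_in_polys_over)
qed

lemma self_in_adjoin: "is_subring A \<Longrightarrow> t \<in> adjoin A t"
  unfolding adjoin_def
  by (intro image_eqI[of _ _ "monom 1 1"]) (auto simp: poly_monom monom_in_polys_over is_subringD)

lemma adjoin_subset: "is_subring B \<Longrightarrow> A \<subseteq> B \<Longrightarrow> t \<in> B \<Longrightarrow> adjoin A t \<subseteq> B"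
  using polys_over_mono[of A B] by (auto simp: adjoin_def intro!: poly_in_subring)

section \<open>Factorial subrings of a domain\<close>

text \<open>Divisibility is relative to \<open>A\<close>: the rings of interest lie in a field such
  as the complex numbers, where \<open>dvd\<close> says nothing about nonzero elements.\<close>

definition dvd_in :: "'a::idom set \<Rightarrow> 'a \<Rightarrow> 'a \<Rightarrow> bool" where
  "dvd_in A x y \<longleftrightarrow> (\<exists>z\<in>A. y = x * z)"

definition prime_in :: "'a::idom set \<Rightarrow> 'a \<Rightarrow> bool" where
  "prime_in A p \<longleftrightarrow> p \<in> A \<and> p \<noteq> 0 \<and> \<not> dvd_in A p 1 \<and>
     (\<forall>x\<in>A. \<forall>y\<in>A. dvd_in A p (x * y) \<longrightarrow> dvd_in A p x \<or> dvd_in A p y)"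

definition prime_fact :: "'a::idom set \<Rightarrow> 'a \<Rightarrow> 'a list \<Rightarrow> bool" where
  "prime_fact A a ps \<longleftrightarrow> (\<forall>p\<in>set ps. prime_in A p) \<and> (\<exists>u\<in>A. dvd_in A u 1 \<and> a = u * prod_list ps)"

text \<open>Existence of factorizations into primes, rather than into irreducibles, characterizes
  factorial domains: uniqueness is a consequence of primality.\<close>

definition factorial_in :: "'a::idom set \<Rightarrow> bool" where
  "factorial_in A \<longleftrightarrow> is_subring A \<and> (\<forall>a\<in>A. a \<noteq> 0 \<longrightarrow> (\<exists>ps. prime_fact A a ps))"

lemma dvd_in_one_mult: "is_subring A \<Longrightarrow> dvd_in A u 1 \<Longrightarrow> dvd_in A v 1 \<Longrightarrow> dvd_in A (u * v) 1"
proof -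
  assume A: "is_subring A" and "dvd_in A u 1" "dvd_in A v 1"
  then obtain a b where ab: "a \<in> A" "b \<in> A" "1 = u * a" "1 = v * b" by (auto simp: dvd_in_def)
  then have "(u * a) * (v * b) = 1" by simp
  then have "1 = (u * v) * (a * b)" by (simp add: mult_ac)
  then show "dvd_in A (u * v) 1" using is_subringD(4)[OF A ab(1,2)] unfolding dvd_in_def by blast
qed

lemma prime_fact_mult:
  assumes "is_subring A" "prime_fact A a ps" "prime_fact A b qs"
  shows "prime_fact A (a * b) (ps @ qs)"
proof -
  obtain u v where uv: "u \<in> A" "dvd_in A u 1" "a = u * prod_list ps" "v \<in> A" "dvd_in A v 1" "b = v * prod_list qs"
    using assms by (auto simp: prime_fact_def)
  have "a * b = (u * v) * prod_list (ps @ qs)" using uv by (simp add: mult_ac)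
  then show ?thesis using assms uv dvd_in_one_mult[OF assms(1) uv(2,5)] is_subringD(4)[OF assms(1) uv(1,4)]
    unfolding prime_fact_def by auto
qed

lemma factorial_in_subfield:
  assumes "is_subring A" "\<And>x. x \<in> A \<Longrightarrow> x \<noteq> 0 \<Longrightarrow> \<exists>y\<in>A. x * y = 1"
  shows "factorial_in A"
  unfolding factorial_in_def
proof (intro conjI ballI impI)
  fix a assume a: "a \<in> A" "a \<noteq> 0"
  then have "dvd_in A a 1" using assms(2)[OF a] by (auto simp: dvd_in_def)
  then have "prime_fact A a []" using a by (auto simp: prime_fact_def)
  then show "\<exists>ps. prime_fact A a ps" ..
qed (fact assms(1))

lemma prime_in_dvd_prod_list:
  assumes "is_subring A" "prime_in A p" "u \<in> A" "dvd_in A u 1" "set ps \<subseteq> A" "dvd_in A p (u * prod_list ps)"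
  shows "\<exists>q\<in>set ps. dvd_in A p q"
  using assms(5,6)
proof (induction ps)
  case Nil
  from Nil obtain z where z: "z \<in> A" "u = p * z" by (auto simp: dvd_in_def)
  obtain w where w: "w \<in> A" "1 = u * w" using assms(4) by (auto simp: dvd_in_def)
  have "1 = p * (z * w)" using z w by (simp add: mult_ac)
  then have "dvd_in A p 1" using z w assms(1) is_subringD(4) unfolding dvd_in_def by blast
  with assms(2) show ?case by (simp add: prime_in_def)
next
  case (Cons q ps)
  have "dvd_in A p (q * (u * prod_list ps))" using Cons.prems by (simp add: mult_ac)
  moreover have "q \<in> A" "u * prod_list ps \<in> A"
    using Cons.prems assms(1,3) by (auto intro!: is_subringD is_subring_prod_list)
  ultimately have "dvd_in A p q \<or> dvd_in A p (u * prod_list ps)"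
    using assms(2) unfolding prime_in_def by blast
  then show ?case using Cons by auto
qed

text \<open>Write \<open>q = p * e\<close> and use that \<open>q\<close> is prime: if it divides
  \<open>p\<close>, then \<open>e\<close> is a unit; if it divides \<open>e\<close>, then
  \<open>p\<close> would be a unit.\<close>

lemma prime_in_dvd_prime_in:
  assumes "is_subring A" "prime_in A p" "prime_in A q" "dvd_in A p q"
  shows "\<exists>e\<in>A. dvd_in A e 1 \<and> q = p * e"
proof -
  obtain e where e: "e \<in> A" "q = p * e" using assms(4) by (auto simp: dvd_in_def)
  have pA: "p \<in> A" and q0: "q \<noteq> 0" "p \<noteq> 0" using assms by (auto simp: prime_in_def)
  have "dvd_in A q (p * e)" using e is_subringD[OF assms(1)] by (auto simp: dvd_in_def intro!: bexI[of _ 1])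
  then have "dvd_in A q p \<or> dvd_in A q e" using assms(3) e pA unfolding prime_in_def by blast
  then show ?thesis
  proof
    assume "dvd_in A q p"
    then obtain z where z: "z \<in> A" "p = q * z" by (auto simp: dvd_in_def)
    then have "p * 1 = p * (e * z)" using e by (metis mult.assoc mult_1_right)
    then have "1 = e * z" using q0 mult_left_cancel by blast
    then show ?thesis using e z by (auto simp: dvd_in_def)
  next
    assume "dvd_in A q e"
    then obtain z where z: "z \<in> A" "e = q * z" by (auto simp: dvd_in_def)
    then have "q * 1 = q * (p * z)" using e(2) by (metis mult.left_commute mult_1_right)
    then have "1 = p * z" using q0 mult_left_cancel by blast
    then have "dvd_in A p 1" using z by (auto simp: dvd_in_def)
    then show ?thesis using assms(2) by (simp add: prime_in_def)
  qed
qed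

text \<open>On \<open>S\<close> the map is an isomorphism onto its image; injectivity is what
  carries divisibility in the image back to \<open>S\<close>, and so preserves primes.\<close>

lemma factorial_in_image:
  fixes f :: "'a::idom \<Rightarrow> 'b::idom"
  assumes fac: "factorial_in S" and f: "f 0 = 0" "f 1 = 1" "\<And>x y. x \<in> S \<Longrightarrow> y \<in> S \<Longrightarrow> f (x + y) = f x + f y"
    "\<And>x y. x \<in> S \<Longrightarrow> y \<in> S \<Longrightarrow> f (x * y) = f x * f y"
    and inj: "inj_on f S"
  shows "factorial_in (f ` S)"
proof -
  have S: "is_subring S" using fac by (simp add: factorial_in_def)
  have dvd: "dvd_in (f ` S) (f x) (f y) \<longleftrightarrow> dvd_in S x y" if "x \<in> S" "y \<in> S" for x y
  proof
    assume "dvd_in (f ` S) (f x) (f y)"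
    then obtain z where z: "z \<in> S" "f y = f x * f z" by (auto simp: dvd_in_def)
    then have "f y = f (x * z)" using f(4) that by simp
    then have "y = x * z" using inj that z is_subringD(4)[OF S] by (auto simp: inj_on_def)
    then show "dvd_in S x y" using z by (auto simp: dvd_in_def)
  next
    assume "dvd_in S x y"
    then show "dvd_in (f ` S) (f x) (f y)" using f(4) that by (auto simp: dvd_in_def)
  qed
  have dvd1: "dvd_in (f ` S) (f x) 1 \<longleftrightarrow> dvd_in S x 1" if "x \<in> S" for x
    using dvd[OF that is_subringD(2)[OF S]] f by simp
  have prime: "prime_in (f ` S) (f p)" if p: "prime_in S p" for p
    unfolding prime_in_def
  proof (intro conjI ballI impI)
    have pS: "p \<in> S" using p by (simp add: prime_in_def)
    then show "f p \<in> f ` S" "\<not> dvd_in (f ` S) (f p) 1" using p dvd1 by (auto simp: prime_in_def)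
    show "f p \<noteq> 0" using p f(1) inj is_subringD(1)[OF S] by (metis inj_onD prime_in_def)
    fix x y assume "x \<in> f ` S" "y \<in> f ` S" "dvd_in (f ` S) (f p) (x * y)"
    then obtain a b where ab: "a \<in> S" "b \<in> S" "x = f a" "y = f b" by blast
    then have "dvd_in S p (a * b)"
      using dvd[OF pS, of "a * b"] f(4) \<open>dvd_in (f ` S) (f p) (x * y)\<close> is_subringD(4)[OF S] by simp
    then have "dvd_in S p a \<or> dvd_in S p b" using p ab unfolding prime_in_def by blast
    then show "dvd_in (f ` S) (f p) x \<or> dvd_in (f ` S) (f p) y" using dvd pS ab by auto
  qed
  have "\<exists>ps. prime_fact (f ` S) b ps" if b: "b \<in> f ` S" "b \<noteq> 0" for b
  proof -
    obtain a where a: "a \<in> S" "b = f a" "a \<noteq> 0" using b f by auto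
    then obtain u ps where ps: "\<forall>p\<in>set ps. prime_in S p" "u \<in> S" "dvd_in S u 1" "a = u * prod_list ps"
      using fac by (auto simp: factorial_in_def prime_fact_def)
    have psS: "set ps \<subseteq> S" using ps by (auto simp: prime_in_def)
    then have "f (prod_list ps) = prod_list (map f ps)"
      using S f by (induction ps) (auto simp: is_subring_prod_list)
    then have "b = f u * prod_list (map f ps)" using a ps f(4) psS S by (simp add: is_subring_prod_list)
    then show ?thesis using prime ps dvd1
      by (intro exI[of _ "map f ps"]) (auto simp: prime_fact_def)
  qed
  then show ?thesis using is_subring_image[OF S f] by (simp add: factorial_in_def)
qed

section \<open>Pseudo-division of polynomials over a domain\<close>

lemma pseudo_division_in:
  fixes d :: "'a::idom poly"
  assumes A: "is_subring A" and d: "d \<in> polys_over A" "d \<noteq> 0" and f: "f \<in> polys_over A"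
  shows "\<exists>c\<in>A. \<exists>q\<in>polys_over A. \<exists>r\<in>polys_over A. c \<noteq> 0 \<and> smult c f = d * q + r \<and> (r = 0 \<or> degree r < degree d)"
  using f
\<comment> \<open>The zero polynomial has degree 0 like the nonzero constants, so the measure ranks
  it strictly below them; this matters when \<open>d\<close> is constant and the remainder drops to
  0.\<close>
proof (induction "if f = 0 then 0 else Suc (degree f)" arbitrary: f rule: less_induct)
  case less
  note P = is_subringD[OF is_subring_polys_over[OF A]] and AD = is_subringD[OF A]
  show ?case
  proof (cases "f = 0 \<or> degree f < degree d")
    case True
    then show ?thesis using less.prems P AD by (intro bexI[of _ 1] bexI[of _ 0] bexI[of _ f]) auto
  next
    case False
    define k where "k = degree f - degree d"
    define m where "m = monom (lead_coeff f) k"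
    \<comment> \<open>Scaling by the leading coefficient of \<open>d\<close> cancels the top term of
      \<open>f\<close> without any division in \<open>A\<close>.\<close>
    define g where "g = smult (lead_coeff d) f - d * m"
    have lc: "lead_coeff f \<in> A" "lead_coeff d \<in> A" using less.prems d by (auto simp: polys_over_def)
    have mP: "m \<in> polys_over A" using lc A by (simp add: m_def monom_in_polys_over)
    have gP: "g \<in> polys_over A"
      unfolding g_def using lc less.prems d mP
      by (intro P smult_in_polys_over[OF A])
    have deg: "degree (d * m) = degree f"
      using False d by (subst degree_mult_eq) (auto simp: m_def k_def degree_monom_eq)
    have "degree g \<le> degree f"
      unfolding g_def using deg by (intro degree_diff_le) auto
    moreover have "coeff g (degree f) = 0"
    proof -
      have "coeff (d * m) (degree f) = lead_coeff d * lead_coeff m" using deg by (metis lead_coeff_mult)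
      moreover have "lead_coeff m = lead_coeff f" by (cases "f = 0") (auto simp: m_def degree_monom_eq)
      ultimately show ?thesis by (simp add: g_def)
    qed
    ultimately have small: "g = 0 \<or> degree g < degree f"
      by (metis le_neq_implies_less leading_coeff_0_iff)
    then have "(if g = 0 then 0 else Suc (degree g)) < (if f = 0 then 0 else Suc (degree f))"
      using False by auto
    from less.hyps[OF this gP] obtain c q r where cqr: "c \<in> A" "q \<in> polys_over A" "r \<in> polys_over A" "c \<noteq> 0"
      "smult c g = d * q + r" "r = 0 \<or> degree r < degree d" by blast
    have "smult (c * lead_coeff d) f = d * (q + smult c m) + r"
    proof -
      have "smult (c * lead_coeff d) f = smult c g + d * smult c m" by (simp add: g_def smult_diff_right)
      then show ?thesis by (simp add: cqr algebra_simps)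
    qed
    moreover have "c * lead_coeff d \<noteq> 0" "c * lead_coeff d \<in> A" using cqr d lc AD by auto
    moreover have "q + smult c m \<in> polys_over A"
      using cqr mP by (intro P smult_in_polys_over[OF A])
    ultimately show ?thesis using cqr by blast
  qed
qed

section \<open>Gauss's lemma and the factorization of polynomials\<close>

lemma dvd_in_sum: "is_subring A \<Longrightarrow> (\<And>i. i \<in> I \<Longrightarrow> dvd_in A p (f i)) \<Longrightarrow> dvd_in A p (sum f I)"
proof (induction I rule: infinite_finite_induct)
  case (insert i I)
  then obtain a b where "a \<in> A" "b \<in> A" "f i = p * a" "sum f I = p * b" by (fastforce simp: dvd_in_def)
  then show ?case using insert by (auto simp: dvd_in_def is_subringD intro!: bexI[of _ "a + b"] simp: distrib_left)
qed (auto simp: dvd_in_def is_subringD intro!: bexI[of _ 0])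

lemma dvd_in_mult: "is_subring A \<Longrightarrow> dvd_in A p x \<Longrightarrow> y \<in> A \<Longrightarrow> dvd_in A p (x * y)"
  by (auto simp: dvd_in_def is_subringD mult.assoc)

lemma dvd_in_add_cancel: "is_subring A \<Longrightarrow> dvd_in A p (x + y) \<Longrightarrow> dvd_in A p y \<Longrightarrow> dvd_in A p x"
proof -
  assume A: "is_subring A" and "dvd_in A p (x + y)" "dvd_in A p y"
  then obtain a b where ab: "a \<in> A" "b \<in> A" "x + y = p * a" "y = p * b" by (auto simp: dvd_in_def)
  then have "x = p * (a - b)" by (metis add_diff_cancel_right' right_diff_distrib)
  then show ?thesis using is_subringD(6)[OF A ab(1,2)] by (auto simp: dvd_in_def)
qed

lemma dvd_in_const_iff:
  assumes A: "is_subring A" and "p \<in> A"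
  shows "dvd_in (polys_over A) [:p:] f \<longleftrightarrow> (\<forall>i. dvd_in A p (coeff f i))"
proof
  assume "dvd_in (polys_over A) [:p:] f"
  then show "\<forall>i. dvd_in A p (coeff f i)" by (auto simp: dvd_in_def polys_over_def)
next
  assume *: "\<forall>i. dvd_in A p (coeff f i)"
  then obtain g where g: "\<And>i. g i \<in> A" "\<And>i. coeff f i = p * g i" unfolding dvd_in_def by metis
  define q where "q = (\<Sum>i\<le>degree f. monom (g i) i)"
  show "dvd_in (polys_over A) [:p:] f"
  \<comment> \<open>For \<open>p = 0\<close> the chosen cofactors \<open>g i\<close> are arbitrary;
    for \<open>p \<noteq> 0\<close> they vanish beyond the degree of \<open>f\<close>, as a
    polynomial requires.\<close>
  proof (cases "p = 0")
    case True
    then have "f = 0" using g by (simp add: poly_eq_iff)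
    then show ?thesis using is_subringD(1)[OF is_subring_polys_over[OF A]] by (auto simp: dvd_in_def)
  next
    case False
    have q: "coeff q i = g i" for i
      using False g(2)[of i] by (cases "i \<le> degree f") (auto simp: q_def coeff_sum coeff_eq_0 simp flip: not_le)
    then have "f = [:p:] * q" using g by (simp add: poly_eq_iff)
    moreover have "q \<in> polys_over A" using q g by (auto simp: polys_over_def)
    ultimately show ?thesis by (auto simp: dvd_in_def)
  qed
qed

text \<open>Gauss's lemma. Take the first coefficients of \<open>f\<close> and \<open>g\<close>, at
  \<open>i\<close> and \<open>j\<close>, that \<open>p\<close> does not divide. In the coefficient
  of \<open>f * g\<close> at \<open>i + j\<close> every summand but
  \<open>coeff f i * coeff g j\<close> has a factor of smaller index and is divisible by
  \<open>p\<close>, so \<open>p\<close> would divide that product too.\<close>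

lemma prime_in_const:
  assumes A: "is_subring A" and p: "prime_in A p"
  shows "prime_in (polys_over A) [:p:]"
  unfolding prime_in_def
proof (intro conjI ballI impI)
  have pA: "p \<in> A" using p by (simp add: prime_in_def)
  show "[:p:] \<in> polys_over A" using pA A by (simp add: const_in_polys_over)
  show "[:p:] \<noteq> 0" using p by (simp add: prime_in_def)
  show "\<not> dvd_in (polys_over A) [:p:] 1"
    using p dvd_in_const_iff[OF A pA, of 1] by (auto simp: prime_in_def dest: spec[of _ 0])
  fix f g assume fg: "f \<in> polys_over A" "g \<in> polys_over A" "dvd_in (polys_over A) [:p:] (f * g)"
  show "dvd_in (polys_over A) [:p:] f \<or> dvd_in (polys_over A) [:p:] g"
  proof (rule ccontr)
    assume "\<not> ?thesis"
    then have ex: "\<exists>i. \<not> dvd_in A p (coeff f i)" "\<exists>i. \<not> dvd_in A p (coeff g i)"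
      unfolding dvd_in_const_iff[OF A pA] by blast+
    define i where "i = (LEAST i. \<not> dvd_in A p (coeff f i))"
    define j where "j = (LEAST i. \<not> dvd_in A p (coeff g i))"
    have i: "\<not> dvd_in A p (coeff f i)" "\<And>k. k < i \<Longrightarrow> dvd_in A p (coeff f k)"
      unfolding i_def using LeastI_ex[OF ex(1)] by (blast dest: not_less_Least)+
    have j: "\<not> dvd_in A p (coeff g j)" "\<And>k. k < j \<Longrightarrow> dvd_in A p (coeff g k)"
      unfolding j_def using LeastI_ex[OF ex(2)] by (blast dest: not_less_Least)+
    have cf: "coeff f k \<in> A" "coeff g k \<in> A" for k using fg by (auto simp: polys_over_def)
    have "coeff (f * g) (i + j) = coeff f i * coeff g j + (\<Sum>k\<in>{..i+j} - {i}. coeff f k * coeff g (i + j - k))"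
      unfolding coeff_mult by (subst sum.remove[of _ i]) auto
    moreover have "dvd_in A p (\<Sum>k\<in>{..i+j} - {i}. coeff f k * coeff g (i + j - k))"
    proof (rule dvd_in_sum[OF A])
      fix k assume k: "k \<in> {..i+j} - {i}"
      show "dvd_in A p (coeff f k * coeff g (i + j - k))"
      proof (cases "k < i")
        case True
        then show ?thesis using i cf A by (intro dvd_in_mult) auto
      next
        case False
        then have "i + j - k < j" using k by auto
        then have "dvd_in A p (coeff g (i + j - k) * coeff f k)" using j cf A by (intro dvd_in_mult) auto
        then show ?thesis by (simp add: mult.commute)
      qed
    qed
    moreover have "dvd_in A p (coeff (f * g) (i + j))" using fg dvd_in_const_iff[OF A pA] by auto
    ultimately have "dvd_in A p (coeff f i * coeff g j)" using dvd_in_add_cancel[OF A] by metis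
    then show False using p i j cf unfolding prime_in_def by blast
  qed
qed

lemma prime_fact_const:
  assumes A: "is_subring A" and a: "prime_fact A a ps"
  shows "prime_fact (polys_over A) [:a:] (map (\<lambda>p. [:p:]) ps)"
proof -
  obtain u v where u: "u \<in> A" "v \<in> A" "1 = u * v" "a = u * prod_list ps"
    using a by (auto simp: prime_fact_def dvd_in_def)
  have "prod_list (map (\<lambda>p. [:p:]) ps) = [:prod_list ps:]"
    by (induction ps) (auto simp: one_pCons)
  then have "[:a:] = [:u:] * prod_list (map (\<lambda>p. [:p:]) ps)" using u by simp
  moreover have "dvd_in (polys_over A) [:u:] 1"
    using u(3) const_in_polys_over[OF A u(2)] unfolding dvd_in_def
    by (intro bexI[of _ "[:v:]"]) (simp_all add: one_pCons mult.commute)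
  ultimately show ?thesis
    using a prime_in_const[OF A] const_in_polys_over[OF A u(1)]
    unfolding prime_fact_def by auto
qed

text \<open>The prime factors of \<open>c\<close> are removed one at a time: such a
  \<open>\<pi>\<close> divides \<open>p * z\<close>, stays prime as a constant polynomial and does
  not divide \<open>p\<close>, so it divides \<open>z\<close> and cancels.\<close>

lemma dvd_in_cancel_const:
  assumes A: "factorial_in A" and c: "c \<in> A" "c \<noteq> 0"
    and p: "p \<in> polys_over A" "\<And>\<pi>. prime_in A \<pi> \<Longrightarrow> \<not> dvd_in (polys_over A) [:\<pi>:] p"
    and x: "x \<in> polys_over A" "dvd_in (polys_over A) p (smult c x)"
  shows "dvd_in (polys_over A) p x"
proof -
  have SA: "is_subring A" using A by (simp add: factorial_in_def)
  obtain ps where "prime_fact A c ps" using A c by (auto simp: factorial_in_def)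
  then show ?thesis using x c
  proof (induction ps arbitrary: c x)
    case Nil
    then obtain u z where u: "u \<in> A" "1 = c * u" "z \<in> polys_over A" "smult c x = p * z"
      by (auto simp: prime_fact_def dvd_in_def)
    have "x = smult u (smult c x)" using u(2) by (simp add: mult.commute)
    also have "\<dots> = p * smult u z" using u by simp
    finally have "x = p * smult u z" .
    then show ?case using smult_in_polys_over[OF SA u(1,3)] unfolding dvd_in_def by blast
  next
    case (Cons \<pi> ps)
    then obtain u where u: "prime_in A \<pi>" "\<forall>p\<in>set ps. prime_in A p" "u \<in> A" "dvd_in A u 1" "c = u * (\<pi> * prod_list ps)"
      by (auto simp: prime_fact_def)
    define c' where "c' = u * prod_list ps"
    have c': "c' \<in> A" "c' \<noteq> 0" "prime_fact A c' ps" "c = \<pi> * c'"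
      using u Cons.prems SA by (auto simp: c'_def prime_fact_def prime_in_def intro!: is_subringD is_subring_prod_list)
    obtain z where z: "z \<in> polys_over A" "smult c x = p * z" using Cons.prems by (auto simp: dvd_in_def)
    have pi: "\<pi> \<in> A" "\<pi> \<noteq> 0" using u by (auto simp: prime_in_def)
    have c'x: "smult c' x \<in> polys_over A" using c' Cons.prems SA by (simp add: smult_in_polys_over)
    have "p * z = [:\<pi>:] * smult c' x" using z(2)[symmetric] c'(4) by (simp add: mult.commute)
    then have "dvd_in (polys_over A) [:\<pi>:] (p * z)" using c'x unfolding dvd_in_def by blast
    then have "dvd_in (polys_over A) [:\<pi>:] z"
      using prime_in_const[OF SA u(1)] p z u(1) unfolding prime_in_def[of "polys_over A"] by blast
    then obtain w where w: "w \<in> polys_over A" "z = [:\<pi>:] * w" by (auto simp: dvd_in_def)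
    have "smult \<pi> (smult c' x) = smult \<pi> (p * w)" using z c' w by simp
    then have "smult c' x = p * w" using pi by (simp add: smult_cancel)
    then show ?case using Cons.IH[OF c'(3), of x] Cons.prems c' w by (auto simp: dvd_in_def)
  qed
qed

text \<open>A factorization over the fraction field is turned into one over \<open>A\<close>: each
  prime factor of \<open>c\<close> divides \<open>d\<close> or \<open>q\<close> and is cancelled
  there. The resulting factors are proportional to \<open>d\<close> and \<open>q\<close>, which
  keeps track of degrees.\<close>

lemma split_const_mult:
  assumes A: "factorial_in A" and c: "c \<in> A" "c \<noteq> 0"
    and p: "p \<in> polys_over A" "d \<in> polys_over A" "q \<in> polys_over A" "smult c p = d * q"
  shows "\<exists>a\<in>A. \<exists>b\<in>A. \<exists>d'\<in>polys_over A. \<exists>q'\<in>polys_over A. a \<noteq> 0 \<and> b \<noteq> 0 \<and> p = d' * q' \<and> d = smult a d' \<and> q = smult b q'"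
proof -
  have SA: "is_subring A" using A by (simp add: factorial_in_def)
  obtain ps where "prime_fact A c ps" using A c by (auto simp: factorial_in_def)
  then show ?thesis using p c
  proof (induction ps arbitrary: c d q)
    case Nil
    then obtain u where u: "u \<in> A" "1 = c * u" by (auto simp: prime_fact_def dvd_in_def)
    have "p = smult u (smult c p)" using u(2) by (simp add: mult.commute)
    also have "\<dots> = smult u d * q" using Nil by simp
    finally have "p = smult u d * q" .
    moreover have "d = smult c (smult u d)" "q = smult 1 q" using u(2) by simp_all
    moreover have "smult u d \<in> polys_over A" using u Nil SA by (simp add: smult_in_polys_over)
    ultimately show ?case using Nil is_subringD(2)[OF SA] one_neq_zero by blast
  next
    case (Cons \<pi> ps)
    then obtain u where u: "prime_in A \<pi>" "\<forall>p\<in>set ps. prime_in A p" "u \<in> A" "dvd_in A u 1" "c = u * (\<pi> * prod_list ps)"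
      by (auto simp: prime_fact_def)
    define c' where "c' = u * prod_list ps"
    have c': "c' \<in> A" "c' \<noteq> 0" "prime_fact A c' ps" "c = \<pi> * c'"
      using u Cons.prems SA by (auto simp: c'_def prime_fact_def prime_in_def intro!: is_subringD is_subring_prod_list)
    have pi: "\<pi> \<in> A" "\<pi> \<noteq> 0" using u by (auto simp: prime_in_def)
    have c'x: "smult c' p \<in> polys_over A" using c' Cons.prems SA by (simp add: smult_in_polys_over)
    have "d * q = [:\<pi>:] * smult c' p" using Cons.prems(5)[symmetric] c'(4) by (simp add: mult.commute)
    then have "dvd_in (polys_over A) [:\<pi>:] (d * q)" using c'x unfolding dvd_in_def by blast
    then have "dvd_in (polys_over A) [:\<pi>:] d \<or> dvd_in (polys_over A) [:\<pi>:] q"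
      using prime_in_const[OF SA u(1)] Cons.prems unfolding prime_in_def[of "polys_over A"] by blast
    then show ?case
    proof
      assume "dvd_in (polys_over A) [:\<pi>:] d"
      then obtain w where w: "w \<in> polys_over A" "d = [:\<pi>:] * w" by (auto simp: dvd_in_def)
      have "smult \<pi> (smult c' p) = smult \<pi> (w * q)" using Cons.prems c' w by simp
      then have "smult c' p = w * q" using pi by (simp add: smult_cancel)
      from Cons.IH[OF c'(3) Cons.prems(2) w(1) Cons.prems(4) this c'(1,2)] obtain a b d' q' where *:
        "a \<in> A" "b \<in> A" "d' \<in> polys_over A" "q' \<in> polys_over A" "a \<noteq> 0" "b \<noteq> 0" "p = d' * q'" "w = smult a d'" "q = smult b q'"
        by blast
      then have "d = smult (\<pi> * a) d'" "\<pi> * a \<in> A" "\<pi> * a \<noteq> 0"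
        using w pi is_subringD(4)[OF SA] by (auto simp: mult.commute)
      then show ?case using * by blast
    next
      assume "dvd_in (polys_over A) [:\<pi>:] q"
      then obtain w where w: "w \<in> polys_over A" "q = [:\<pi>:] * w" by (auto simp: dvd_in_def)
      have "smult \<pi> (smult c' p) = smult \<pi> (d * w)" using Cons.prems c' w by simp
      then have "smult c' p = d * w" using pi by (simp add: smult_cancel)
      from Cons.IH[OF c'(3) Cons.prems(2,3) w(1) this c'(1,2)] obtain a b d' q' where *:
        "a \<in> A" "b \<in> A" "d' \<in> polys_over A" "q' \<in> polys_over A" "a \<noteq> 0" "b \<noteq> 0" "p = d' * q'" "d = smult a d'" "w = smult b q'"
        by blast
      then have "q = smult (\<pi> * b) q'" "\<pi> * b \<in> A" "\<pi> * b \<noteq> 0"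
        using w pi is_subringD(4)[OF SA] by (auto simp: mult.commute)
      then show ?case using * by blast
    qed
  qed
qed

text \<open>A constant prime dividing \<open>p\<close> divides its leading coefficient, hence is
  associated to one of the listed prime factors \<open>ps\<close>. Taking it out shortens the list,
  so the extraction stops.\<close>

lemma content_split:
  assumes A: "factorial_in A" and p: "p \<in> polys_over A" "p \<noteq> 0"
  shows "\<exists>a\<in>A. \<exists>p'\<in>polys_over A. a \<noteq> 0 \<and> p = smult a p' \<and> (\<forall>\<pi>. prime_in A \<pi> \<longrightarrow> \<not> dvd_in (polys_over A) [:\<pi>:] p')"
proof -
  have SA: "is_subring A" using A by (simp add: factorial_in_def)
  have "lead_coeff p \<in> A" "lead_coeff p \<noteq> 0" using p by (auto simp: polys_over_def)
  then obtain ps where "prime_fact A (lead_coeff p) ps" using A by (auto simp: factorial_in_def)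
  then show ?thesis using p
  proof (induction "length ps" arbitrary: ps p rule: less_induct)
    case less
    show ?case
    proof (cases "\<exists>\<pi>. prime_in A \<pi> \<and> dvd_in (polys_over A) [:\<pi>:] p")
      case False
      then show ?thesis using less.prems is_subringD(2)[OF SA] by (intro bexI[of _ 1] bexI[of _ p]) auto
    next
      case True
      then obtain \<pi> p1 where pi: "prime_in A \<pi>" and p1: "p1 \<in> polys_over A" "p = smult \<pi> p1"
        by (auto simp: dvd_in_def)
      have piA: "\<pi> \<in> A" "\<pi> \<noteq> 0" using pi by (auto simp: prime_in_def)
      have lc: "lead_coeff p = \<pi> * lead_coeff p1" using p1 by simp
      obtain u where u: "u \<in> A" "dvd_in A u 1" "lead_coeff p = u * prod_list ps" "\<forall>q\<in>set ps. prime_in A q"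
        using less.prems by (auto simp: prime_fact_def)
      have "dvd_in A \<pi> (u * prod_list ps)"
        using lc u(3) p1(1) by (auto simp: dvd_in_def polys_over_def)
      then obtain q where q: "q \<in> set ps" "dvd_in A \<pi> q"
        using prime_in_dvd_prod_list[OF SA pi u(1,2), of ps] u(4) by (auto simp: prime_in_def)
      then obtain e where e: "e \<in> A" "dvd_in A e 1" "q = \<pi> * e"
        using prime_in_dvd_prime_in[OF SA pi, of q] u(4) by auto
      obtain ps1 ps2 where ps: "ps = ps1 @ q # ps2" using q(1) by (meson split_list)
      have "\<pi> * lead_coeff p1 = \<pi> * ((u * e) * prod_list (ps1 @ ps2))"
        unfolding lc[symmetric] u(3) by (simp add: ps e(3) mult_ac)
      then have "lead_coeff p1 = (u * e) * prod_list (ps1 @ ps2)" using piA(2) mult_left_cancel by blast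
      then have fac: "prime_fact A (lead_coeff p1) (ps1 @ ps2)"
        using u(4) ps is_subringD(4)[OF SA u(1) e(1)] dvd_in_one_mult[OF SA u(2) e(2)]
        unfolding prime_fact_def by auto
      have "p1 \<noteq> 0" using p1 less.prems by auto
      from less.hyps[OF _ fac p1(1) this] ps obtain a p' where
        *: "a \<in> A" "p' \<in> polys_over A" "a \<noteq> 0" "p1 = smult a p'"
           "\<forall>\<pi>. prime_in A \<pi> \<longrightarrow> \<not> dvd_in (polys_over A) [:\<pi>:] p'" by auto
      moreover have "p = smult (\<pi> * a) p'" using p1 *(4) by simp
      moreover have "\<pi> * a \<in> A" "\<pi> * a \<noteq> 0" using piA * is_subringD(4)[OF SA] by auto
      ultimately show ?thesis by blast
    qed
  qed
qed

text \<open>If \<open>p\<close> divides \<open>f g\<close>, consider an element \<open>d\<close> of minimal degree in the ideal \<open>(p, f)\<close>. Up to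
  factors from \<open>A\<close>, which can be cancelled, \<open>d\<close> divides \<open>p\<close> and \<open>f\<close>. If \<open>d\<close> has the degree of \<open>p\<close>, then
  \<open>p\<close> divides \<open>f\<close>; if \<open>d\<close> is constant, then \<open>p\<close> divides \<open>d g\<close> and therefore \<open>g\<close>.\<close>

lemma primitive_irreducible_prime_in:
  assumes A: "factorial_in A" and p: "p \<in> polys_over A" "degree p > 0"
    and prim: "\<And>\<pi>. prime_in A \<pi> \<Longrightarrow> \<not> dvd_in (polys_over A) [:\<pi>:] p"
    and irr: "\<And>x y. x \<in> polys_over A \<Longrightarrow> y \<in> polys_over A \<Longrightarrow> p = x * y \<Longrightarrow> degree x = 0 \<or> degree y = 0"
  shows "prime_in (polys_over A) p"
  unfolding prime_in_def
proof (intro conjI ballI impI)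
  have SA: "is_subring A" using A by (simp add: factorial_in_def)
  note SP = is_subring_polys_over[OF SA]
  show "p \<in> polys_over A" by fact
  show "p \<noteq> 0" using p by auto
  show "\<not> dvd_in (polys_over A) p 1"
  proof
    assume "dvd_in (polys_over A) p 1"
    then obtain z where z: "1 = p * z" by (auto simp: dvd_in_def)
    then have "degree (p * z) = 0" by (metis degree_1)
    moreover have "z \<noteq> 0" "p \<noteq> 0" using z by auto
    ultimately show False using p by (simp add: degree_mult_eq)
  qed
  fix f g assume fg: "f \<in> polys_over A" "g \<in> polys_over A" "dvd_in (polys_over A) p (f * g)"
  define J where "J = {p * a + f * b | a b. a \<in> polys_over A \<and> b \<in> polys_over A}"
  have JI: "x - d * q \<in> J" if xd: "x \<in> J" "d \<in> J" "q \<in> polys_over A" for x d q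
  proof -
    obtain a b a' b' where ab: "x = p * a + f * b" "d = p * a' + f * b'" "a \<in> polys_over A" "b \<in> polys_over A"
      "a' \<in> polys_over A" "b' \<in> polys_over A"
      using xd(1,2) unfolding J_def by blast
    then have "x - d * q = p * (a - a' * q) + f * (b - b' * q)" by (simp add: algebra_simps)
    moreover have "a - a' * q \<in> polys_over A" "b - b' * q \<in> polys_over A"
      using ab xd(3) by (auto intro!: is_subringD[OF SP])
    ultimately show ?thesis unfolding J_def by blast
  qed
  have Jp: "smult c p \<in> J" "smult c f \<in> J" if "c \<in> A" for c
  proof -
    have "[:c:] \<in> polys_over A" "0 \<in> polys_over A" using that const_in_polys_over[OF SA] is_subringD[OF SP] by auto
    moreover have "smult c p = p * [:c:] + f * 0" "smult c f = p * 0 + f * [:c:]" by auto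
    ultimately show "smult c p \<in> J" "smult c f \<in> J" unfolding J_def by blast+
  qed
  have "p \<in> J" using Jp(1)[of 1] is_subringD(2)[OF SA] by simp
  then have "\<exists>d. d \<in> J \<and> d \<noteq> 0 \<and> (\<forall>e. e \<in> J \<and> e \<noteq> 0 \<longrightarrow> degree d \<le> degree e)"
    using ex_has_least_nat[of "\<lambda>d. d \<in> J \<and> d \<noteq> 0" p degree] p(2) by (metis degree_0 less_irrefl)
  then obtain d where d: "d \<in> J" "d \<noteq> 0" "\<And>e. e \<in> J \<Longrightarrow> e \<noteq> 0 \<Longrightarrow> degree d \<le> degree e"
    by blast
  have JP: "J \<subseteq> polys_over A" unfolding J_def using p fg is_subringD[OF SP] by auto
  have div: "\<exists>c\<in>A. \<exists>q\<in>polys_over A. c \<noteq> 0 \<and> smult c x = d * q"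
    if x: "x \<in> polys_over A" "\<And>c. c \<in> A \<Longrightarrow> smult c x \<in> J" for x
  proof -
    obtain c q r where cqr: "c \<in> A" "q \<in> polys_over A" "c \<noteq> 0" "smult c x = d * q + r" "r = 0 \<or> degree r < degree d"
      using pseudo_division_in[OF SA _ d(2) x(1)] d(1) JP by blast
    have "r = smult c x - d * q" using cqr by simp
    then have "r \<in> J" using JI x(2)[OF cqr(1)] d(1) cqr(2) by simp
    then have "r = 0" using d(3) cqr(5) by force
    then show ?thesis using cqr by auto
  qed
  obtain c q where cq: "c \<in> A" "q \<in> polys_over A" "c \<noteq> 0" "smult c p = d * q"
    using div[OF p(1) Jp(1)] by blast
  obtain a b d' q' where split: "a \<in> A" "b \<in> A" "d' \<in> polys_over A" "q' \<in> polys_over A" "a \<noteq> 0" "b \<noteq> 0"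
    "p = d' * q'" "d = smult a d'" "q = smult b q'"
    using split_const_mult[OF A cq(1,3) p(1) _ cq(2,4)] d(1) JP by blast
  from irr[OF split(3,4,7)] show "dvd_in (polys_over A) p f \<or> dvd_in (polys_over A) p g"
  proof
    assume "degree d' = 0"
    then obtain e where e: "d = [:e:]" using split(8) by (metis degree_smult_eq degree_eq_zeroE)
    then have eA: "e \<in> A" "e \<noteq> 0" using d JP by (auto simp: pCons_in_polys_over_iff)
    obtain \<alpha> \<beta> where ab: "d = p * \<alpha> + f * \<beta>" "\<alpha> \<in> polys_over A" "\<beta> \<in> polys_over A" using d(1) by (auto simp: J_def)
    obtain w where w: "w \<in> polys_over A" "f * g = p * w" using fg by (auto simp: dvd_in_def)
    have "smult e g = d * g" using e by simp
    also have "\<dots> = p * \<alpha> * g + (f * g) * \<beta>" by (simp add: ab(1) algebra_simps)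
    also have "\<dots> = p * (\<alpha> * g + w * \<beta>)" by (simp add: w(2) algebra_simps)
    finally have "smult e g = p * (\<alpha> * g + w * \<beta>)" .
    moreover have "\<alpha> * g + w * \<beta> \<in> polys_over A" using ab w fg is_subringD[OF SP] by auto
    ultimately have "dvd_in (polys_over A) p (smult e g)" unfolding dvd_in_def by blast
    then show ?thesis using dvd_in_cancel_const[OF A eA p(1) prim fg(2)] by blast
  next
    assume "degree q' = 0"
    then obtain e where e: "q' = [:e:]" by (metis degree_eq_zeroE)
    have pe: "p = smult e d'" using split(7) e by simp
    have eA: "e \<in> A" "e \<noteq> 0" using split(4) e p(2) pe by (auto simp: pCons_in_polys_over_iff)
    obtain c2 q2 where cq2: "c2 \<in> A" "q2 \<in> polys_over A" "c2 \<noteq> 0" "smult c2 f = d * q2"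
      using div[OF fg(1) Jp(2)] by blast
    \<comment> \<open>From \<open>p = e d'\<close>, \<open>d = a d'\<close> and
      \<open>c2 f = d q2\<close> it follows that \<open>e c2 f = a p q2\<close>.\<close>
    have "smult (e * c2) f = smult e (smult c2 f)" by simp
    also have "\<dots> = p * smult a q2" unfolding cq2(4) pe split(8) by (simp add: mult.commute)
    finally have "dvd_in (polys_over A) p (smult (e * c2) f)"
      using smult_in_polys_over[OF SA split(1) cq2(2)] unfolding dvd_in_def by blast
    moreover have "e * c2 \<in> A" "e * c2 \<noteq> 0" using eA cq2 is_subringD(4)[OF SA] by auto
    ultimately show ?thesis using dvd_in_cancel_const[OF A _ _ p(1) prim fg(1), of "e * c2"] by blast
  qed
qed

text \<open>Gauss's theorem, by induction on the degree. The content factors in \<open>A\<close>;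
  the primitive part is constant, or splits into factors of smaller positive degree, or is prime by
  \<open>primitive_irreducible_prime_in\<close>.\<close>

lemma factorial_in_polys_over:
  assumes A: "factorial_in A"
  shows "factorial_in (polys_over A)"
proof -
  have SA: "is_subring A" using A by (simp add: factorial_in_def)
  note SP = is_subring_polys_over[OF SA]
  have "\<exists>ps. prime_fact (polys_over A) f ps" if "f \<in> polys_over A" "f \<noteq> 0" for f
    using that
  proof (induction "degree f" arbitrary: f rule: less_induct)
    case less
    obtain a p where ap: "a \<in> A" "p \<in> polys_over A" "a \<noteq> 0" "f = smult a p"
      "\<And>\<pi>. prime_in A \<pi> \<Longrightarrow> \<not> dvd_in (polys_over A) [:\<pi>:] p"
      using content_split[OF A less.prems] by blast
    have cfact: "\<exists>ps. prime_fact (polys_over A) [:c:] ps" if "c \<in> A" "c \<noteq> 0" for c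
      using A that prime_fact_const[OF SA] by (force simp: factorial_in_def)
    have p0: "p \<noteq> 0" and deg: "degree p = degree f" using ap less.prems by auto
    have "\<exists>ps. prime_fact (polys_over A) p ps"
    proof (cases "degree p = 0")
      case True
      then obtain c where "p = [:c:]" by (metis degree_eq_zeroE)
      then show ?thesis using cfact[of c] ap(2) p0 by (auto simp: pCons_in_polys_over_iff)
    next
      case dp: False
      show ?thesis
      proof (cases "\<exists>x\<in>polys_over A. \<exists>y\<in>polys_over A. p = x * y \<and> degree x > 0 \<and> degree y > 0")
        case True
        then obtain x y where xy: "x \<in> polys_over A" "y \<in> polys_over A" "p = x * y" "degree x > 0" "degree y > 0" by blast
        then have "x \<noteq> 0" "y \<noteq> 0" by auto
        moreover from this have "degree x < degree f" "degree y < degree f"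
          using xy deg by (auto simp: degree_mult_eq)
        ultimately obtain ps qs where "prime_fact (polys_over A) x ps" "prime_fact (polys_over A) y qs"
          using less.hyps xy by blast
        then show ?thesis using prime_fact_mult[OF SP] xy(3) by blast
      next
        case False
        then have "prime_in (polys_over A) p"
          using dp by (intro primitive_irreducible_prime_in[OF A ap(2)] ap(5)) auto
        moreover have "p = 1 * prod_list [p]" "dvd_in (polys_over A) 1 1" "1 \<in> polys_over A"
          using is_subringD[OF SP] by (auto simp: dvd_in_def)
        ultimately have "prime_fact (polys_over A) p [p]" unfolding prime_fact_def by fastforce
        then show ?thesis ..
      qed
    qed
    moreover have "f = [:a:] * p" using ap by simp
    ultimately show ?case using cfact[OF ap(1,3)] prime_fact_mult[OF SP] by metis
  qed
  then show ?thesis using SP by (simp add: factorial_in_def)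
qed

section \<open>Transcendental generators and the ideal of polynomials vanishing at a point\<close>

definition transc_over :: "'a::comm_ring_1 set \<Rightarrow> 'a \<Rightarrow> bool" where
  "transc_over A t \<longleftrightarrow> (\<forall>p\<in>polys_over A. poly p t = 0 \<longrightarrow> p = 0)"

text \<open>For transcendental \<open>t\<close>, evaluation at \<open>t\<close> identifies the
  polynomial ring over \<open>A\<close> with the ring generated by \<open>t\<close>.\<close>

lemma factorial_in_adjoin:
  assumes A: "factorial_in A" and t: "transc_over A t"
  shows "factorial_in (adjoin A t)"
proof -
  have SP: "is_subring (polys_over A)"
    using A by (simp add: factorial_in_def is_subring_polys_over)
  have "inj_on (\<lambda>p. poly p t) (polys_over A)"
  proof (rule inj_onI)
    fix p q assume "p \<in> polys_over A" "q \<in> polys_over A" "poly p t = poly q t"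
    then show "p = q" using t is_subringD(6)[OF SP, of p q] by (auto simp: transc_over_def)
  qed
  then show ?thesis unfolding adjoin_def
    by (intro factorial_in_image factorial_in_polys_over A) auto
qed

lemma vanishing_ideal_principal:
  assumes A: "factorial_in A" and p0: "p0 \<in> polys_over A" "p0 \<noteq> 0" "poly p0 v = 0"
  shows "\<exists>g\<in>polys_over A. poly g v = 0 \<and> (\<forall>p\<in>polys_over A. poly p v = 0 \<longrightarrow> dvd_in (polys_over A) g p)"
proof -
  have SA: "is_subring A" using A by (simp add: factorial_in_def)
  note SP = is_subring_polys_over[OF SA]
  define I where "I = (\<lambda>p. p \<in> polys_over A \<and> p \<noteq> 0 \<and> poly p v = 0)"
  have "I p0" using p0 by (simp add: I_def)
  then have "\<exists>m. I m \<and> (\<forall>e. I e \<longrightarrow> degree m \<le> degree e)"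
    by (rule ex_has_least_nat)
  then obtain m where m: "I m" "\<And>e. I e \<Longrightarrow> degree m \<le> degree e" by blast
  then obtain u ps where ps: "u \<in> polys_over A" "dvd_in (polys_over A) u 1" "m = u * prod_list ps" "\<And>q. q \<in> set ps \<Longrightarrow> prime_in (polys_over A) q"
    using factorial_in_polys_over[OF A] by (auto simp: factorial_in_def prime_fact_def I_def)
  have u: "poly u v \<noteq> 0"
  proof
    assume *: "poly u v = 0"
    obtain z where "1 = u * z" using ps(2) by (auto simp: dvd_in_def)
    then have "poly (u * z) v = 1" by (metis poly_1)
    then show False using * by simp
  qed
  have "poly (prod_list ps) v = 0" using m(1) ps(3) u by (simp add: I_def)
  then have "\<exists>g\<in>set ps. poly g v = 0" by (induction ps) auto
  then obtain g where g: "g \<in> set ps" "poly g v = 0" by blast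
  have prime: "prime_in (polys_over A) g" using ps(4) g by blast
  then have gP: "g \<in> polys_over A" "g \<noteq> 0" by (auto simp: prime_in_def)
  have "g dvd m" using g(1) ps(3) by (auto dest: prod_list_dvd intro: dvd_mult)
  then have "degree g \<le> degree m" using m(1) by (simp add: I_def dvd_imp_degree_le)
  moreover have "I g" using g gP by (simp add: I_def)
  \<comment> \<open>A divisor of \<open>m\<close> that itself vanishes at \<open>v\<close> inherits
    the minimality of the degree.\<close>
  ultimately have min: "\<And>e. I e \<Longrightarrow> degree g \<le> degree e" using m(2) by fastforce
  have "dvd_in (polys_over A) g p" if p: "p \<in> polys_over A" "poly p v = 0" for p
  proof -
    obtain c q r where cqr: "c \<in> A" "q \<in> polys_over A" "r \<in> polys_over A" "c \<noteq> 0" "smult c p = g * q + r" "r = 0 \<or> degree r < degree g"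
      using pseudo_division_in[OF SA gP p(1)] by blast
    have "poly (smult c p) v = poly (g * q + r) v" using cqr(5) by simp
    then have "poly r v = 0" using p g by simp
    then have "r = 0" using min[of r] cqr(3,6) by (cases "r = 0") (auto simp: I_def)
    then have "[:c:] * p = g * q" using cqr(5) by simp
    then have "dvd_in (polys_over A) g ([:c:] * p)" using cqr(2) by (auto simp: dvd_in_def)
    \<comment> \<open>Here primality disposes of the denominator: a nonzero constant does not vanish
      at \<open>v\<close>, so \<open>g\<close> cannot divide it and must divide
      \<open>p\<close>.\<close>
    then have "dvd_in (polys_over A) g [:c:] \<or> dvd_in (polys_over A) g p"
      using prime p(1) const_in_polys_over[OF SA cqr(1)] unfolding prime_in_def by blast
    moreover have False if "dvd_in (polys_over A) g [:c:]"
    proof -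
      from that obtain z where "[:c:] = g * z" by (auto simp: dvd_in_def)
      then have "poly [:c:] v = poly (g * z) v" by (rule arg_cong)
      then show False using g cqr(4) by simp
    qed
    ultimately show ?thesis by blast
  qed
  then show ?thesis using gP g by blast
qed

section \<open>Relative algebraic closure\<close>

text \<open>Fraction-free Gaussian elimination, by induction on the number of equations; all
  coefficients and solutions stay in \<open>A\<close>.\<close>

lemma homogeneous_system_in:
  fixes a :: "'i \<Rightarrow> 'j \<Rightarrow> 'a::idom"
  assumes A: "is_subring A" and "finite J" "finite I" "card J < card I" "\<And>i j. i \<in> I \<Longrightarrow> j \<in> J \<Longrightarrow> a i j \<in> A"
  shows "\<exists>c. (\<forall>i\<in>I. c i \<in> A) \<and> (\<exists>i\<in>I. c i \<noteq> 0) \<and> (\<forall>j\<in>J. (\<Sum>i\<in>I. c i * a i j) = 0)"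
  using assms(2-)
proof (induction J arbitrary: I a)
  case empty
  then have "I \<noteq> {}" by auto
  then show ?case using is_subringD(2)[OF A] by (intro exI[of _ "\<lambda>_. 1"]) auto
next
  case (insert j0 J)
  show ?case
  proof (cases "\<forall>i\<in>I. a i j0 = 0")
    case True
    have "card J < card I" using insert by simp
    from insert.IH[OF insert.prems(1) this, of a] insert.prems(3) show ?thesis using True by auto
  next
    case False
    then obtain i0 where i0: "i0 \<in> I" "a i0 j0 \<noteq> 0" by blast
    \<comment> \<open>The system left after eliminating the unknown \<open>i0\<close> by means of
      equation \<open>j0\<close>, with pivot \<open>a i0 j0\<close>; its entries are 2 by 2
      minors.\<close>
    define b where "b = (\<lambda>i j. a i0 j0 * a i j - a i j0 * a i0 j)"
    have "card J < card (I - {i0})" using insert i0 by simp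
    moreover have "b i j \<in> A" if "i \<in> I - {i0}" "j \<in> J" for i j
      using that insert.prems(3) i0 by (auto simp: b_def intro!: is_subringD[OF A])
    ultimately have "\<exists>c. (\<forall>i\<in>I-{i0}. c i \<in> A) \<and> (\<exists>i\<in>I-{i0}. c i \<noteq> 0) \<and> (\<forall>j\<in>J. (\<Sum>i\<in>I-{i0}. c i * b i j) = 0)"
      using insert.prems(1) by (intro insert.IH) auto
    then obtain c where c: "\<And>i. i \<in> I - {i0} \<Longrightarrow> c i \<in> A" "\<exists>i\<in>I-{i0}. c i \<noteq> 0"
      "\<And>j. j \<in> J \<Longrightarrow> (\<Sum>i\<in>I-{i0}. c i * b i j) = 0" by blast
    \<comment> \<open>Multiplying the solution \<open>c\<close> by the pivot allows equation
      \<open>j0\<close> to be solved for the unknown \<open>i0\<close> without division.\<close>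
    define e where "e = (\<lambda>i. if i = i0 then - (\<Sum>k\<in>I-{i0}. c k * a k j0) else c i * a i0 j0)"
    have "e i \<in> A" if "i \<in> I" for i
      using that c(1) insert.prems(3) i0 by (auto simp: e_def intro!: is_subringD[OF A] is_subring_sum[OF A])
    moreover have "\<exists>i\<in>I. e i \<noteq> 0" using c(2) i0 by (auto simp: e_def)
    moreover have "(\<Sum>i\<in>I. e i * a i j) = 0" if j: "j \<in> insert j0 J" for j
    proof -
      have "(\<Sum>i\<in>I. e i * a i j) = e i0 * a i0 j + (\<Sum>i\<in>I-{i0}. e i * a i j)"
        using i0 insert.prems(1) by (simp add: sum.remove)
      also have "(\<Sum>i\<in>I-{i0}. e i * a i j) = (\<Sum>i\<in>I-{i0}. c i * (a i0 j0 * a i j))"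
        by (intro sum.cong) (auto simp: e_def)
      also have "e i0 * a i0 j = - (\<Sum>i\<in>I-{i0}. c i * (a i j0 * a i0 j))"
        by (simp add: e_def sum_distrib_right mult.assoc)
      finally have "(\<Sum>i\<in>I. e i * a i j) = (\<Sum>i\<in>I-{i0}. c i * b i j)"
        by (simp add: b_def right_diff_distrib sum_subtractf)
      \<comment> \<open>Equation \<open>j0\<close> holds because each minor \<open>b i j0\<close> is
        zero.\<close>
      also have "\<dots> = 0" using c(3) j by (cases "j = j0") (auto simp: b_def mult.commute)
      finally show ?thesis .
    qed
    ultimately show ?thesis by blast
  qed
qed

text \<open>The span of \<open>w\<close> over the fraction field of \<open>A\<close>, without forming that field.\<close>

definition frac_span :: "'a::idom set \<Rightarrow> 'j set \<Rightarrow> ('j \<Rightarrow> 'a) \<Rightarrow> 'a set" where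
  "frac_span A J w = {v. \<exists>c\<in>A. c \<noteq> 0 \<and> (\<exists>a. (\<forall>j\<in>J. a j \<in> A) \<and> c * v = (\<Sum>j\<in>J. a j * w j))}"

lemma frac_spanI: "c \<in> A \<Longrightarrow> c \<noteq> 0 \<Longrightarrow> (\<And>j. j \<in> J \<Longrightarrow> a j \<in> A) \<Longrightarrow> c * v = (\<Sum>j\<in>J. a j * w j) \<Longrightarrow> v \<in> frac_span A J w"
  unfolding frac_span_def by blast

lemma frac_spanE:
  assumes "v \<in> frac_span A J w"
  obtains c a where "c \<in> A" "c \<noteq> 0" "\<And>j. j \<in> J \<Longrightarrow> a j \<in> A" "c * v = (\<Sum>j\<in>J. a j * w j)"
  using assms unfolding frac_span_def by blast

context
  fixes A :: "'a::idom set" and J :: "'j set" and w :: "'j \<Rightarrow> 'a"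
  assumes A: "is_subring A" and J: "finite J"
begin

lemma frac_span_base: "j \<in> J \<Longrightarrow> w j \<in> frac_span A J w"
  using J is_subringD[OF A]
  by (intro frac_spanI[of 1 _ _ "\<lambda>i. if i = j then 1 else 0"]) (auto simp: if_distrib[of "\<lambda>x. x * _"] cong: if_cong)

lemma frac_span_zero: "0 \<in> frac_span A J w"
  using is_subringD[OF A] by (intro frac_spanI[of 1 _ _ "\<lambda>_. 0"]) auto

lemma frac_span_add:
  assumes "u \<in> frac_span A J w" "v \<in> frac_span A J w"
  shows "u + v \<in> frac_span A J w"
proof -
  obtain c a where 1: "c \<in> A" "c \<noteq> 0" "\<And>j. j \<in> J \<Longrightarrow> a j \<in> A" "c * u = (\<Sum>j\<in>J. a j * w j)"
    using assms(1) by (elim frac_spanE) blast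
  obtain d b where 2: "d \<in> A" "d \<noteq> 0" "\<And>j. j \<in> J \<Longrightarrow> b j \<in> A" "d * v = (\<Sum>j\<in>J. b j * w j)"
    using assms(2) by (elim frac_spanE) blast
  have "(c * d) * (u + v) = d * (c * u) + c * (d * v)" by (simp add: algebra_simps)
  also have "\<dots> = (\<Sum>j\<in>J. (d * a j + c * b j) * w j)"
    unfolding 1 2 by (simp add: sum_distrib_left sum.distrib distrib_right mult.assoc)
  finally show ?thesis using 1 2
    by (intro frac_spanI[of "c * d" _ _ "\<lambda>j. d * a j + c * b j"]) (auto intro!: is_subringD[OF A])
qed

lemma frac_span_sum: "(\<And>i. i \<in> I \<Longrightarrow> f i \<in> frac_span A J w) \<Longrightarrow> sum f I \<in> frac_span A J w"
  by (induction I rule: infinite_finite_induct) (auto intro: frac_span_add frac_span_zero)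

lemma frac_span_scale:
  assumes "v \<in> frac_span A J w" "b \<in> A"
  shows "b * v \<in> frac_span A J w"
proof -
  obtain c a where 1: "c \<in> A" "c \<noteq> 0" "\<And>j. j \<in> J \<Longrightarrow> a j \<in> A" "c * v = (\<Sum>j\<in>J. a j * w j)"
    using assms(1) by (elim frac_spanE) blast
  have "c * (b * v) = (\<Sum>j\<in>J. (b * a j) * w j)"
    unfolding mult.left_commute[of c] 1 by (simp add: sum_distrib_left mult.assoc)
  then show ?thesis using 1 assms(2)
    by (intro frac_spanI[of c _ _ "\<lambda>j. b * a j"]) (auto intro!: is_subringD[OF A])
qed

lemma frac_span_unscale:
  assumes "c * v \<in> frac_span A J w" "c \<in> A" "c \<noteq> 0"
  shows "v \<in> frac_span A J w"
proof -
  obtain d a where 1: "d \<in> A" "d \<noteq> 0" "\<And>j. j \<in> J \<Longrightarrow> a j \<in> A" "d * (c * v) = (\<Sum>j\<in>J. a j * w j)"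
    using assms(1) by (elim frac_spanE) blast
  then show ?thesis using assms(2,3) is_subringD[OF A]
    by (intro frac_spanI[of "d * c" _ _ a]) (auto simp: mult.assoc)
qed

lemma frac_span_mult:
  assumes "\<And>j. j \<in> J \<Longrightarrow> y * w j \<in> frac_span A J w" "v \<in> frac_span A J w"
  shows "y * v \<in> frac_span A J w"
proof -
  obtain c a where 1: "c \<in> A" "c \<noteq> 0" "\<And>j. j \<in> J \<Longrightarrow> a j \<in> A" "c * v = (\<Sum>j\<in>J. a j * w j)"
    using assms(2) by (elim frac_spanE) blast
  have "c * (y * v) = (\<Sum>j\<in>J. a j * (y * w j))"
    unfolding mult.left_commute[of c] 1 by (simp add: sum_distrib_left mult.left_commute)
  also have "\<dots> \<in> frac_span A J w"
    by (rule frac_span_sum, rule frac_span_scale) (use 1 assms(1) in auto)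
  finally show ?thesis by (rule frac_span_unscale) (use 1 in auto)
qed

end

section \<open>Elements algebraic over a subring\<close>

definition alg_closure :: "'a::idom set \<Rightarrow> 'a set" where
  "alg_closure A = {x. \<exists>p\<in>polys_over A. p \<noteq> 0 \<and> poly p x = 0}"

lemma transc_over_iff: "transc_over A t \<longleftrightarrow> t \<notin> alg_closure A"
  by (auto simp: transc_over_def alg_closure_def)

text \<open>The \<open>card J + 1\<close> powers of \<open>y\<close> up to exponent
  \<open>card J\<close> lie in a span of \<open>card J\<close> vectors, so they satisfy a nontrivial
  linear relation. Each power has its own denominator \<open>c k\<close>, which ends up in the
  coefficient \<open>d k * c k\<close>.\<close>

lemma alg_closureI_frac_span:
  fixes w :: "'j \<Rightarrow> 'a::idom"
  assumes A: "is_subring A" and J: "finite J" and one: "1 \<in> frac_span A J w"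
    and y: "\<And>j. j \<in> J \<Longrightarrow> y * w j \<in> frac_span A J w"
  shows "y \<in> alg_closure A"
proof -
  have "y ^ k \<in> frac_span A J w" for k
    by (induction k) (use one frac_span_mult[OF A J y] in auto)
  then have "\<forall>k. \<exists>c a. c \<in> A \<and> c \<noteq> 0 \<and> (\<forall>j\<in>J. a j \<in> A) \<and> c * y ^ k = (\<Sum>j\<in>J. a j * w j)"
    unfolding frac_span_def by blast
  then obtain c a where ca: "\<And>k. c k \<in> A" "\<And>k. c k \<noteq> 0" "\<And>k j. j \<in> J \<Longrightarrow> a k j \<in> A"
    "\<And>k. c k * y ^ k = (\<Sum>j\<in>J. a k j * w j)" by metis
  have "\<exists>d. (\<forall>k\<in>{..card J}. d k \<in> A) \<and> (\<exists>k\<in>{..card J}. d k \<noteq> 0) \<and> (\<forall>j\<in>J. (\<Sum>k\<le>card J. d k * a k j) = 0)"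
    using ca(3) by (intro homogeneous_system_in[OF A J]) auto
  then obtain d where d: "\<And>k. k \<in> {..card J} \<Longrightarrow> d k \<in> A" "\<exists>k\<in>{..card J}. d k \<noteq> 0"
    "\<And>j. j \<in> J \<Longrightarrow> (\<Sum>k\<le>card J. d k * a k j) = 0" by blast
  define p where "p = (\<Sum>k\<le>card J. monom (d k * c k) k)"
  have cf: "coeff p k = (if k \<le> card J then d k * c k else 0)" for k
    by (simp add: p_def coeff_sum)
  have "p \<in> polys_over A" using cf ca d is_subringD[OF A] by (simp add: polys_over_def)
  moreover obtain k where "k \<in> {..card J}" "d k \<noteq> 0" using d(2) by blast
  then have "coeff p k \<noteq> 0" using cf ca(2) by simp
  then have "p \<noteq> 0" by auto
  moreover have "poly p y = (\<Sum>k\<le>card J. d k * (c k * y ^ k))"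
    by (simp add: p_def poly_sum poly_monom mult.assoc)
  then have "poly p y = (\<Sum>k\<le>card J. \<Sum>j\<in>J. d k * a k j * w j)"
    by (simp add: ca(4) sum_distrib_left mult.assoc)
  then have "poly p y = (\<Sum>j\<in>J. (\<Sum>k\<le>card J. d k * a k j) * w j)"
    by (simp add: sum_distrib_right sum.swap[of _ J])
  then have "poly p y = 0" using d(3) by simp
  ultimately show ?thesis by (auto simp: alg_closure_def)
qed

lemma alg_closureE:
  assumes "x \<in> alg_closure A"
  obtains p where "p \<in> polys_over A" "p \<noteq> 0" "degree p > 0" "poly p x = 0"
    "lead_coeff p * x ^ degree p = - (\<Sum>i<degree p. coeff p i * x ^ i)"
proof -
  obtain p where p: "p \<in> polys_over A" "p \<noteq> 0" "poly p x = 0" using assms by (auto simp: alg_closure_def)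
  have "degree p > 0"
  proof (rule ccontr)
    assume "\<not> degree p > 0"
    then obtain c where "p = [:c:]" by (auto elim: degree_eq_zeroE)
    then show False using p by auto
  qed
  moreover have "(\<Sum>i<degree p. coeff p i * x ^ i) + lead_coeff p * x ^ degree p = 0"
    using p(3) by (simp add: poly_altdef flip: lessThan_Suc_atMost)
  then have "lead_coeff p * x ^ degree p = - (\<Sum>i<degree p. coeff p i * x ^ i)"
    by (simp add: eq_neg_iff_add_eq_0 add.commute)
  ultimately show ?thesis using p that by blast
qed

lemma alg_closure_mono: "A \<subseteq> B \<Longrightarrow> alg_closure A \<subseteq> alg_closure B"
  using polys_over_mono[of A B] unfolding alg_closure_def by blast

lemma subset_alg_closure: "is_subring A \<Longrightarrow> A \<subseteq> alg_closure A"
proof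
  fix x assume "is_subring A" "x \<in> A"
  then show "x \<in> alg_closure A"
    unfolding alg_closure_def using is_subringD[of A]
    by (auto intro!: bexI[of _ "[:- x, 1:]"] simp: pCons_in_polys_over_iff is_subringD(1)[OF is_subring_polys_over])
qed

text \<open>Take for \<open>m\<close> the degree of an equation of \<open>x\<close>. Its leading
  coefficient is invertible in the fraction field of \<open>A\<close>, so \<open>x ^ m\<close> falls
  back into the span of the lower powers.\<close>

lemma frac_span_powers:
  assumes A: "is_subring A" and x: "x \<in> alg_closure A"
  obtains m where "m > 0" "\<And>v. v \<in> frac_span A {..<m} (\<lambda>i. x ^ i) \<Longrightarrow> x * v \<in> frac_span A {..<m} (\<lambda>i. x ^ i)"
proof -
  obtain p where p: "p \<in> polys_over A" "p \<noteq> 0" "degree p > 0"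
    "lead_coeff p * x ^ degree p = - (\<Sum>i<degree p. coeff p i * x ^ i)"
    using x by (rule alg_closureE)
  define V where "V = frac_span A {..<degree p} (\<lambda>i. x ^ i)"
  have cf: "coeff p i \<in> A" for i using p by (simp add: polys_over_def)
  have "- (\<Sum>i<degree p. coeff p i * x ^ i) = (\<Sum>i<degree p. (- coeff p i) * x ^ i)" by (simp add: sum_negf)
  also have "\<dots> \<in> V" unfolding V_def
    by (rule frac_span_sum[OF A finite_lessThan, OF frac_span_scale[OF A finite_lessThan, OF frac_span_base[OF A finite_lessThan]]])
      (use is_subringD(5)[OF A cf] in auto)
  finally have top: "x ^ degree p \<in> V"
    unfolding V_def p(4)[symmetric] by (rule frac_span_unscale[OF A finite_lessThan]) (use cf p in auto)
  have "x * v \<in> V" if "v \<in> V" for v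
    unfolding V_def
  proof (rule frac_span_mult[OF A finite_lessThan])
    fix j assume j: "j \<in> {..<degree p}"
    show "x * x ^ j \<in> frac_span A {..<degree p} (\<lambda>i. x ^ i)"
    proof (cases "Suc j = degree p")
      case True
      then show ?thesis using top by (simp add: V_def flip: power_Suc)
    next
      case False
      then show ?thesis using j frac_span_base[OF A finite_lessThan, of "Suc j" "degree p" "\<lambda>i. x ^ i"] by simp
    qed
  qed (use that in \<open>auto simp: V_def\<close>)
  then show ?thesis using that p(3) by (auto simp: V_def)
qed

text \<open>The span of the powers below \<open>m\<close> is the field generated by \<open>x\<close>
  over the fraction field of \<open>A\<close>. The lemmas of this block provide what transitivity of
  algebraicity takes from that: it contains \<open>adjoin A x\<close>, is closed under products, and
  contains the inverses of nonzero elements of \<open>adjoin A x\<close>.\<close>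

context
  fixes A :: "'a::field set" and x :: 'a and m :: nat
  assumes A: "is_subring A" and m: "m > 0"
    and clos: "\<And>v. v \<in> frac_span A {..<m} (\<lambda>i. x ^ i) \<Longrightarrow> x * v \<in> frac_span A {..<m} (\<lambda>i. x ^ i)"
begin

lemma frac_span_powers_adjoin:
  assumes "y \<in> adjoin A x" "v \<in> frac_span A {..<m} (\<lambda>i. x ^ i)"
  shows "y * v \<in> frac_span A {..<m} (\<lambda>i. x ^ i)"
proof -
  obtain p where p: "p \<in> polys_over A" "y = poly p x" using assms by (auto simp: adjoin_def)
  have "x ^ i * v \<in> frac_span A {..<m} (\<lambda>i. x ^ i)" for i
    by (induction i) (use assms clos in \<open>auto simp: mult.assoc\<close>)
  then have "(\<Sum>i\<le>degree p. coeff p i * (x ^ i * v)) \<in> frac_span A {..<m} (\<lambda>i. x ^ i)"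
    by (rule frac_span_sum[OF A finite_lessThan, OF frac_span_scale[OF A finite_lessThan]])
      (use p in \<open>auto simp: polys_over_def\<close>)
  then show ?thesis by (simp add: p poly_altdef sum_distrib_right mult.assoc)
qed

lemma one_in_frac_span_powers: "1 \<in> frac_span A {..<m} (\<lambda>i. x ^ i)"
  using frac_span_base[OF A finite_lessThan, of 0 m "\<lambda>i. x ^ i"] m by simp

lemma adjoin_subset_frac_span_powers: "adjoin A x \<subseteq> frac_span A {..<m} (\<lambda>i. x ^ i)"
  using frac_span_powers_adjoin[OF _ one_in_frac_span_powers] by auto

lemma adjoin_subset_alg_closure_aux: "adjoin A x \<subseteq> alg_closure A"
proof
  fix y assume y: "y \<in> adjoin A x"
  show "y \<in> alg_closure A"
    by (rule alg_closureI_frac_span[OF A _ one_in_frac_span_powers])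
      (use frac_span_powers_adjoin[OF y] frac_span_base[OF A finite_lessThan, of _ m "\<lambda>i. x ^ i"] in auto)
qed

lemma frac_span_powers_mult:
  assumes "u \<in> frac_span A {..<m} (\<lambda>i. x ^ i)" "v \<in> frac_span A {..<m} (\<lambda>i. x ^ i)"
  shows "u * v \<in> frac_span A {..<m} (\<lambda>i. x ^ i)"
proof -
  obtain c a where 1: "c \<in> A" "c \<noteq> 0" "\<And>j. j \<in> {..<m} \<Longrightarrow> a j \<in> A" "c * u = (\<Sum>j<m. a j * x ^ j)"
    using assms(1) by (elim frac_spanE) blast
  have "c * u \<in> adjoin A x"
    unfolding 1 using is_subring_adjoin[OF A, of x] self_in_adjoin[OF A, of x] subset_adjoin[OF A, of x] 1(3)
    by (intro is_subring_sum is_subringD(4) is_subring_power) auto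
  then have "c * (u * v) \<in> frac_span A {..<m} (\<lambda>i. x ^ i)"
    using frac_span_powers_adjoin[OF _ assms(2), of "c * u"] by (simp add: mult.assoc)
  then show ?thesis by (rule frac_span_unscale[OF A finite_lessThan]) (use 1 in auto)
qed

text \<open>An equation \<open>c + y * q(y) = 0\<close> of least degree has
  \<open>c \<noteq> 0\<close>, since otherwise a factor \<open>y\<close> could be cancelled. Hence
  the inverse of \<open>y\<close> is \<open>- q(y) / c\<close>, with a denominator from
  \<open>A\<close>.\<close>

lemma frac_span_powers_inverse:
  assumes y: "y \<in> adjoin A x" "y \<noteq> 0"
  shows "inverse y \<in> frac_span A {..<m} (\<lambda>i. x ^ i)"
proof -
  define P where "P = (\<lambda>p. p \<in> polys_over A \<and> p \<noteq> 0 \<and> poly p y = 0)"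
  have "\<exists>p. P p" using adjoin_subset_alg_closure_aux y by (auto simp: alg_closure_def P_def)
  then obtain p where p: "P p" "\<And>q. P q \<Longrightarrow> degree p \<le> degree q"
    using ex_has_least_nat[of P _ degree] by blast
  obtain c q where cq: "p = pCons c q" by (rule pCons_cases)
  then have cA: "c \<in> A" "q \<in> polys_over A" "c + y * poly q y = 0" using p by (auto simp: P_def pCons_in_polys_over_iff)
  have "c \<noteq> 0"
  proof
    assume c: "c = 0"
    then have "P q" using cq p cA y by (auto simp: P_def)
    moreover have "degree p = Suc (degree q)" using cq c p by (auto simp: P_def)
    ultimately show False using p(2)[of q] by simp
  qed
  have "c * inverse y = - poly q y" using cA(3) y(2) by (simp add: field_simps eq_neg_iff_add_eq_0)
  also have "- poly q y \<in> adjoin A x"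
    using cA y subset_adjoin[OF A, of x] polys_over_mono[of A "adjoin A x"] is_subring_adjoin[OF A, of x]
    by (intro is_subringD(5) poly_in_subring) auto
  finally have "c * inverse y \<in> frac_span A {..<m} (\<lambda>i. x ^ i)" using adjoin_subset_frac_span_powers by blast
  then show ?thesis by (rule frac_span_unscale[OF A finite_lessThan]) (use cA \<open>c \<noteq> 0\<close> in auto)
qed

text \<open>Transitivity of algebraicity: with \<open>d\<close> the degree of an equation of
  \<open>z\<close> over \<open>adjoin A x\<close>, the products \<open>x ^ i * z ^ j\<close> for
  \<open>i < m\<close>, \<open>j < d\<close> have a span over the fraction field of \<open>A\<close>
  that is stable under multiplication by \<open>z\<close>.\<close>

lemma alg_closure_adjoin_aux:
  assumes z: "z \<in> alg_closure (adjoin A x)"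
  shows "z \<in> alg_closure A"
proof -
  let ?V = "frac_span A {..<m} (\<lambda>i. x ^ i)"
  obtain q where q: "q \<in> polys_over (adjoin A x)" "q \<noteq> 0" "degree q > 0"
    "lead_coeff q * z ^ degree q = - (\<Sum>i<degree q. coeff q i * z ^ i)"
    using z by (rule alg_closureE)
  define d where "d = degree q"
  have fin: "finite ({..<m} \<times> {..<d})" by simp
  define W where "W = frac_span A ({..<m} \<times> {..<d}) (\<lambda>(i, j). x ^ i * z ^ j)"
  have VW: "v * z ^ j \<in> W" if vj: "v \<in> ?V" "j < d" for v j
  proof -
    obtain c a where 1: "c \<in> A" "c \<noteq> 0" "\<And>j. j \<in> {..<m} \<Longrightarrow> a j \<in> A" "c * v = (\<Sum>j<m. a j * x ^ j)"
      using vj(1) by (elim frac_spanE) blast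
    have "c * (v * z ^ j) = (c * v) * z ^ j" by simp
    also have "\<dots> = (\<Sum>i<m. a i * (case (i, j) of (i, j) \<Rightarrow> x ^ i * z ^ j))"
      unfolding 1(4) by (simp add: sum_distrib_right mult.assoc)
    also have "\<dots> \<in> W" unfolding W_def
      by (rule frac_span_sum[OF A fin, OF frac_span_scale[OF A fin, OF frac_span_base[OF A fin]]])
        (use vj(2) 1(3) in auto)
    finally show ?thesis unfolding W_def by (rule frac_span_unscale[OF A fin]) (use 1 in auto)
  qed
  have pow: "x ^ i \<in> ?V" if "i < m" for i
    using frac_span_base[OF A finite_lessThan, of i m "\<lambda>i. x ^ i"] that by simp
  have cf: "coeff q j \<in> adjoin A x" for j using q by (simp add: polys_over_def)
  show ?thesis
  proof (rule alg_closureI_frac_span[OF A])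
    show "finite ({..<m} \<times> {..<d})" by simp
    show "1 \<in> frac_span A ({..<m} \<times> {..<d}) (\<lambda>(i, j). x ^ i * z ^ j)"
      using VW[OF one_in_frac_span_powers, of 0] q(3) by (simp add: W_def d_def)
    fix ij assume ij: "ij \<in> {..<m} \<times> {..<d}"
    then obtain i j where [simp]: "ij = (i, j)" and ij: "i < m" "j < d" by auto
    have "x ^ i * z ^ Suc j \<in> W"
    proof (cases "Suc j = d")
      case False
      then show ?thesis using VW[OF pow[OF ij(1)], of "Suc j"] ij(2) by simp
    next
      case True
      \<comment> \<open>The leading coefficient of \<open>q\<close> lies in
        \<open>adjoin A x\<close>, and its inverse lies in the span of the powers of
        \<open>x\<close>; so solving for \<open>z ^ d\<close> keeps the coefficients in that
        span.\<close>
      have "lead_coeff q * (x ^ i * z ^ d) = x ^ i * (lead_coeff q * z ^ d)" by simp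
      also have "\<dots> = - (\<Sum>k<d. x ^ i * coeff q k * z ^ k)"
        using q(4) by (simp add: d_def sum_distrib_left mult.assoc)
      finally have "inverse (lead_coeff q) * (lead_coeff q * (x ^ i * z ^ d)) =
          inverse (lead_coeff q) * - (\<Sum>k<d. x ^ i * coeff q k * z ^ k)" by simp
      then have "x ^ i * z ^ d = (\<Sum>k<d. (- coeff q k) * (x ^ i * inverse (lead_coeff q)) * z ^ k)"
        using q(2) by (simp add: sum_distrib_left sum_negf mult_ac)
      also have "\<dots> \<in> W" unfolding W_def
      proof (rule frac_span_sum[OF A fin], fold W_def)
        fix k assume "k \<in> {..<d}"
        moreover have "- coeff q k * (x ^ i * inverse (lead_coeff q)) \<in> ?V"
          using q(2) cf ij is_subringD(5)[OF is_subring_adjoin[OF A] cf]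
          by (intro frac_span_powers_adjoin frac_span_powers_mult frac_span_powers_inverse pow) auto
        ultimately show "- coeff q k * (x ^ i * inverse (lead_coeff q)) * z ^ k \<in> W" by (intro VW) auto
      qed
      finally show ?thesis using True by simp
    qed
    then show "z * (case ij of (i, j) \<Rightarrow> x ^ i * z ^ j) \<in> frac_span A ({..<m} \<times> {..<d}) (\<lambda>(i, j). x ^ i * z ^ j)"
      by (simp add: W_def mult.left_commute)
  qed
qed

end

lemma alg_closure_adjoin:
  fixes A :: "'a::field set"
  assumes A: "is_subring A" and x: "x \<in> alg_closure A"
  shows "alg_closure (adjoin A x) \<subseteq> alg_closure A"
proof -
  obtain m where m: "m > 0" "\<And>v. v \<in> frac_span A {..<m} (\<lambda>i. x ^ i) \<Longrightarrow> x * v \<in> frac_span A {..<m} (\<lambda>i. x ^ i)"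
    using frac_span_powers[OF A x] by blast
  show ?thesis using alg_closure_adjoin_aux[OF A m] by blast
qed

lemma adjoin_subset_alg_closure:
  fixes A :: "'a::field set"
  assumes "is_subring A" "x \<in> alg_closure A"
  shows "adjoin A x \<subseteq> alg_closure A"
  using alg_closure_adjoin[OF assms] subset_alg_closure[OF is_subring_adjoin[OF assms(1)]] by blast

section \<open>Finitely generated rings and algebraically closed subrings\<close>

fun gen :: "'a::comm_ring_1 set \<Rightarrow> 'a list \<Rightarrow> 'a set" where
  "gen A [] = A"
| "gen A (t # ts) = adjoin (gen A ts) t"

lemma is_subring_gen: "is_subring A \<Longrightarrow> is_subring (gen A ts)"
  by (induction ts) (auto simp: is_subring_adjoin)

lemma gen_superset: "is_subring A \<Longrightarrow> A \<union> set ts \<subseteq> gen A ts"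
proof (induction ts)
  case (Cons t ts)
  then show ?case
    using subset_adjoin[OF is_subring_gen[of A ts], of t] self_in_adjoin[OF is_subring_gen[of A ts], of t] by auto
qed auto

lemma gen_minimal: "is_subring B \<Longrightarrow> A \<union> set ts \<subseteq> B \<Longrightarrow> gen A ts \<subseteq> B"
  by (induction ts) (auto dest: adjoin_subset)

lemma alg_closure_gen:
  fixes A :: "'a::field set"
  assumes A: "is_subring A"
  shows "set ts \<subseteq> alg_closure A \<Longrightarrow> alg_closure (gen A ts) \<subseteq> alg_closure A"
proof (induction ts)
  case (Cons t ts)
  have "A \<subseteq> gen A ts" using gen_superset[OF A, of ts] by simp
  then have "t \<in> alg_closure (gen A ts)" using Cons.prems alg_closure_mono by auto
  then show ?case using Cons alg_closure_adjoin[OF is_subring_gen[OF A]] by fastforce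
qed auto

definition alg_closed_in :: "'a::field set \<Rightarrow> bool" where
  "alg_closed_in C \<longleftrightarrow> is_subring C \<and> alg_closure C \<subseteq> C"

text \<open>Everything reduces to rings generated by finitely many algebraic elements, where
  \<open>alg_closure_gen\<close> applies: two elements for sums and products, the coefficients of
  one polynomial for idempotence.\<close>

lemma alg_closed_in_alg_closure:
  fixes A :: "'a::field set"
  assumes A: "is_subring A"
  shows "alg_closed_in (alg_closure A)"
proof -
  have two: "x + y \<in> alg_closure A \<and> x * y \<in> alg_closure A" if "x \<in> alg_closure A" "y \<in> alg_closure A" for x y
  proof -
    let ?G = "gen A [y, x]"
    have "x \<in> ?G" "y \<in> ?G" using gen_superset[OF A, of "[y, x]"] by auto
    then have "x + y \<in> ?G" "x * y \<in> ?G" using is_subringD(3,4)[OF is_subring_gen[OF A]] by blast+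
    moreover have "?G \<subseteq> alg_closure A"
      using subset_alg_closure[OF is_subring_gen[OF A, of "[y, x]"]] alg_closure_gen[OF A, of "[y, x]"] that by auto
    ultimately show ?thesis by blast
  qed
  have neg: "- x \<in> alg_closure A" if "x \<in> alg_closure A" for x
    using adjoin_subset_alg_closure[OF A that] self_in_adjoin[OF A, of x] is_subringD(5)[OF is_subring_adjoin[OF A]] by blast
  have sub: "is_subring (alg_closure A)"
    using two neg subset_alg_closure[OF A] is_subringD(1,2)[OF A] by (auto simp: is_subring_def)
  have "alg_closure (alg_closure A) \<subseteq> alg_closure A"
  proof
    fix z assume "z \<in> alg_closure (alg_closure A)"
    then obtain p where p: "p \<in> polys_over (alg_closure A)" "p \<noteq> 0" "poly p z = 0" by (auto simp: alg_closure_def)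
    have "coeff p i \<in> gen A (coeffs p)" for i
    proof (cases "coeff p i = 0")
      case True
      then show ?thesis using is_subringD(1)[OF is_subring_gen[OF A]] by simp
    next
      case False
      then have "coeff p i \<in> set (coeffs p)" by (simp add: coeff_in_coeffs le_degree p(2))
      then show ?thesis using gen_superset[OF A] by blast
    qed
    then have "z \<in> alg_closure (gen A (coeffs p))" using p by (auto simp: alg_closure_def polys_over_def)
    moreover have "set (coeffs p) \<subseteq> alg_closure A"
      using p(1) by (auto simp: polys_over_def coeffs_def)
    ultimately show "z \<in> alg_closure A" using alg_closure_gen[OF A] by blast
  qed
  with sub show ?thesis by (simp add: alg_closed_in_def)
qed

lemma alg_closed_in_Inter: "(\<And>C. C \<in> \<C> \<Longrightarrow> alg_closed_in C) \<Longrightarrow> alg_closed_in (\<Inter>\<C>)"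
proof -
  assume C: "\<And>C. C \<in> \<C> \<Longrightarrow> alg_closed_in C"
  have "alg_closure (\<Inter>\<C>) \<subseteq> C" if "C \<in> \<C>" for C
    using C[OF that] alg_closure_mono[of "\<Inter>\<C>" C] that by (auto simp: alg_closed_in_def)
  moreover have "is_subring (\<Inter>\<C>)"
    using C by (auto simp: alg_closed_in_def is_subring_def)
  ultimately show ?thesis by (auto simp: alg_closed_in_def)
qed

section \<open>Algebraic dependence\<close>

locale subring_of_field =
  fixes K :: "'a::field set"
  assumes K: "is_subring K"
begin

text \<open>As a hull, \<open>cl\<close> is monotone and idempotent by general principles;
  \<open>alg_closure_gen_eq_cl\<close> gives the concrete form on finite sets, the algebraic closure
  of the generated ring.\<close>

definition cl :: "'a set \<Rightarrow> 'a set" where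
  "cl X = alg_closed_in hull (K \<union> X)"

lemma cl_closed: "alg_closed_in (cl X)"
  unfolding cl_def by (rule hull_in) (auto intro: alg_closed_in_Inter)

lemma is_subring_cl: "is_subring (cl X)"
  using cl_closed by (simp add: alg_closed_in_def)

lemma cl_superset: "K \<union> X \<subseteq> cl X"
  unfolding cl_def by (rule hull_subset)

lemma cl_minimal: "K \<union> X \<subseteq> C \<Longrightarrow> alg_closed_in C \<Longrightarrow> cl X \<subseteq> C"
  unfolding cl_def by (rule hull_minimal)

lemma cl_mono: "X \<subseteq> Y \<Longrightarrow> cl X \<subseteq> cl Y"
  using cl_superset[of Y] by (intro cl_minimal cl_closed) auto

lemma cl_subset_cl: "X \<subseteq> cl Y \<Longrightarrow> cl X \<subseteq> cl Y"
  using cl_superset[of Y] by (intro cl_minimal cl_closed) auto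

lemma alg_closure_gen_eq_cl: "alg_closure (gen K ts) = cl (set ts)"
proof
  have "gen K ts \<subseteq> cl (set ts)" using is_subring_cl cl_superset by (rule gen_minimal)
  then show "alg_closure (gen K ts) \<subseteq> cl (set ts)"
    using alg_closure_mono cl_closed unfolding alg_closed_in_def by blast
  show "cl (set ts) \<subseteq> alg_closure (gen K ts)"
    using gen_superset[OF K, of ts] subset_alg_closure[OF is_subring_gen[OF K, of ts]]
    by (intro cl_minimal alg_closed_in_alg_closure is_subring_gen K) auto
qed

lemma cl_insert_subset: "cl (insert y X) \<subseteq> alg_closure (adjoin (cl X) y)"
proof (rule cl_minimal)
  have "cl X \<union> {y} \<subseteq> adjoin (cl X) y"
    using subset_adjoin[OF is_subring_cl[of X], of y] self_in_adjoin[OF is_subring_cl[of X], of y] by auto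
  moreover have "adjoin (cl X) y \<subseteq> alg_closure (adjoin (cl X) y)"
    by (intro subset_alg_closure is_subring_adjoin is_subring_cl)
  ultimately show "K \<union> insert y X \<subseteq> alg_closure (adjoin (cl X) y)" using cl_superset[of X] by blast
  show "alg_closed_in (alg_closure (adjoin (cl X) y))"
    by (intro alg_closed_in_alg_closure is_subring_adjoin is_subring_cl)
qed

text \<open>An algebraic equation for \<open>x\<close> with coefficients in \<open>cl X [y]\<close> is rearranged
  as an equation for \<open>y\<close> with coefficients in \<open>cl X [x]\<close>.\<close>

lemma exchange:
  assumes "x \<in> cl (insert y X)" "x \<notin> cl X"
  shows "y \<in> cl (insert x X)"
proof -
  let ?A = "cl X"
  note A = is_subring_cl[of X]
  obtain p where p: "p \<in> polys_over (adjoin ?A y)" "p \<noteq> 0" "poly p x = 0"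
    using assms(1) cl_insert_subset[of y X] by (auto simp: alg_closure_def)
  have "\<forall>i. \<exists>q. q \<in> polys_over ?A \<and> coeff p i = poly q y"
  proof
    fix i
    have "coeff p i \<in> adjoin ?A y" using p(1) by (simp add: polys_over_def)
    then show "\<exists>q. q \<in> polys_over ?A \<and> coeff p i = poly q y" unfolding adjoin_def by blast
  qed
  then obtain q where q: "\<And>i. q i \<in> polys_over ?A" "\<And>i. coeff p i = poly (q i) y" by metis
  define D where "D = (\<Sum>i\<le>degree p. degree (q i))"
  \<comment> \<open>When \<open>p\<close> is read as a polynomial in \<open>x\<close> and
    \<open>y\<close>, \<open>b j\<close> collects the coefficient of \<open>y ^ j\<close>;
    \<open>D\<close> bounds all degrees in \<open>y\<close>, so that the double sum can be
    interchanged.\<close>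
  define b where "b = (\<lambda>j. \<Sum>i\<le>degree p. monom (coeff (q i) j) i)"
  have bA: "b j \<in> polys_over ?A" for j
    unfolding b_def using q(1) by (intro is_subring_sum is_subring_polys_over A monom_in_polys_over) (auto simp: polys_over_def)
  define r where "r = (\<Sum>j\<le>D. monom (poly (b j) x) j)"
  have cr: "coeff r j = (if j \<le> D then poly (b j) x else 0)" for j
    by (simp add: r_def coeff_sum)
  have deg: "degree (q i) \<le> D" if "i \<le> degree p" for i
    unfolding D_def using that by (intro member_le_sum) auto
  have "r \<noteq> 0"
  proof -
    have "q (degree p) \<noteq> 0" using q(2)[of "degree p"] p(2) by auto
    then have lc: "lead_coeff (q (degree p)) \<noteq> 0" by simp
    let ?j = "degree (q (degree p))"
    have "coeff (b ?j) (degree p) = lead_coeff (q (degree p))" by (simp add: b_def coeff_sum)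
    then have "b ?j \<noteq> 0" using lc by auto
    \<comment> \<open>Since \<open>x\<close> is transcendental over \<open>cl X\<close>, a nonzero
      coefficient polynomial stays nonzero after substituting \<open>x\<close>, and the rearranged
      equation is not trivial.\<close>
    moreover have "x \<notin> alg_closure ?A" using assms(2) cl_closed by (auto simp: alg_closed_in_def)
    ultimately have "poly (b ?j) x \<noteq> 0" using bA by (auto simp: alg_closure_def)
    then have "coeff r ?j \<noteq> 0" using cr deg[of "degree p"] by simp
    then show ?thesis by auto
  qed
  moreover have "r \<in> polys_over (adjoin ?A x)"
  proof -
    have "poly (b j) x \<in> adjoin ?A x" for j using bA by (simp add: adjoin_def)
    then have "coeff r j \<in> adjoin ?A x" for j using cr is_subringD(1)[OF is_subring_adjoin[OF A]] by simp
    then show ?thesis by (simp add: polys_over_def)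
  qed
  moreover have "poly r y = 0"
  proof -
    have "poly r y = (\<Sum>j\<le>D. \<Sum>i\<le>degree p. coeff (q i) j * x ^ i * y ^ j)"
      by (simp add: r_def b_def poly_sum poly_monom sum_distrib_right)
    also have "\<dots> = (\<Sum>i\<le>degree p. \<Sum>j\<le>D. coeff (q i) j * x ^ i * y ^ j)" by (rule sum.swap)
    also have "\<dots> = (\<Sum>i\<le>degree p. coeff p i * x ^ i)"
    proof (rule sum.cong)
      fix i assume "i \<in> {..degree p}"
      then have "poly (q i) y = (\<Sum>j\<le>D. coeff (q i) j * y ^ j)"
        unfolding poly_altdef using deg by (intro sum.mono_neutral_left) (auto simp: coeff_eq_0)
      then show "(\<Sum>j\<le>D. coeff (q i) j * x ^ i * y ^ j) = coeff p i * x ^ i"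
        by (simp add: q(2) sum_distrib_left mult_ac)
    qed simp
    also have "\<dots> = 0" using p(3) by (simp add: poly_altdef)
    finally show ?thesis .
  qed
  ultimately have "y \<in> alg_closure (adjoin ?A x)" by (auto simp: alg_closure_def)
  moreover have "adjoin ?A x \<subseteq> cl (insert x X)"
    using cl_superset[of "insert x X"] cl_mono[of X "insert x X"] by (intro adjoin_subset is_subring_cl) auto
  ultimately show ?thesis using alg_closure_mono[of "adjoin ?A x"] cl_closed unfolding alg_closed_in_def by blast
qed

section \<open>Independent sets and the comparison of their sizes\<close>

definition indep :: "'a set \<Rightarrow> bool" where
  "indep Y \<longleftrightarrow> (\<forall>y\<in>Y. y \<notin> cl (Y - {y}))"

lemma indep_insert:
  assumes "indep Y" "x \<notin> cl Y"
  shows "indep (insert x Y)"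
  unfolding indep_def
proof
  have xY: "x \<notin> Y" using assms(2) cl_superset[of Y] by blast
  fix z assume z: "z \<in> insert x Y"
  show "z \<notin> cl (insert x Y - {z})"
  proof (cases "z = x")
    case True
    then show ?thesis using assms(2) xY by simp
  next
    case False
    then have zY: "z \<in> Y" using z by simp
    show ?thesis
    proof
      assume "z \<in> cl (insert x Y - {z})"
      moreover have "insert x Y - {z} = insert x (Y - {z})" using False by auto
      moreover have "z \<notin> cl (Y - {z})" using assms(1) zY by (simp add: indep_def)
      ultimately have "x \<in> cl (insert z (Y - {z}))" using exchange by metis
      then show False using assms(2) zY by (simp add: insert_absorb)
    qed
  qed
qed

lemma indep_subset: "indep Y \<Longrightarrow> Z \<subseteq> Y \<Longrightarrow> indep Z"
  unfolding indep_def
proof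
  fix y assume Y: "\<forall>y\<in>Y. y \<notin> cl (Y - {y})" "Z \<subseteq> Y" and "y \<in> Z"
  then have "y \<notin> cl (Y - {y})" by blast
  moreover have "cl (Z - {y}) \<subseteq> cl (Y - {y})" using Y(2) by (intro cl_mono) auto
  ultimately show "y \<notin> cl (Z - {y})" by blast
qed

text \<open>Steinitz exchange: a member of \<open>Y\<close> outside \<open>X\<close> is traded for a
  member of \<open>X\<close>. This keeps the size and the independence of \<open>Y\<close> while
  \<open>Y - X\<close> shrinks.\<close>

lemma indep_card_le:
  assumes "finite X" "finite Y" "indep Y" "Y \<subseteq> cl X"
  shows "card Y \<le> card X"
  using assms(2-)
proof (induction "card (Y - X)" arbitrary: Y rule: less_induct)
  case less
  show ?case
  proof (cases "Y \<subseteq> X")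
    case True
    then show ?thesis using assms(1) by (simp add: card_mono)
  next
    case False
    then obtain y where y: "y \<in> Y" "y \<notin> X" by blast
    \<comment> \<open>Otherwise \<open>y\<close>, which lies in \<open>cl X\<close>, would lie in
      \<open>cl (Y - {y})\<close>.\<close>
    have "\<not> X \<subseteq> cl (Y - {y})"
      using cl_subset_cl[of X "Y - {y}"] less.prems y(1) by (auto simp: indep_def)
    then obtain x where x: "x \<in> X" "x \<notin> cl (Y - {y})" by blast
    then have xY: "x \<notin> Y - {y}" using cl_superset[of "Y - {y}"] by blast
    let ?Z = "insert x (Y - {y})"
    have "indep ?Z" using indep_insert[OF indep_subset[OF less.prems(2)] x(2)] by auto
    moreover have "?Z \<subseteq> cl X" using less.prems(3) x(1) cl_superset[of X] by blast
    moreover have "?Z - X = (Y - X) - {y}" using x by auto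
    then have "card (?Z - X) < card (Y - X)"
      using y less.prems(1) by (metis DiffI card_Diff1_less finite_Diff)
    ultimately have "card ?Z \<le> card X" using less.hyps less.prems(1) by simp
    moreover have "card ?Z = card Y" using xY y less.prems(1) card_Suc_Diff1[of Y y] by (simp del: card_Diff_singleton)
    ultimately show ?thesis by simp
  qed
qed

lemma indep_basis_exists:
  assumes "finite S"
  obtains T where "T \<subseteq> S" "indep T" "S \<subseteq> cl T"
proof -
  have fin: "finite {T. T \<subseteq> S \<and> indep T}" using assms by simp
  have ne: "{} \<in> {T. T \<subseteq> S \<and> indep T}" by (simp add: indep_def)
  obtain T where T: "T \<subseteq> S" "indep T" "\<And>U. U \<subseteq> S \<Longrightarrow> indep U \<Longrightarrow> T \<subseteq> U \<Longrightarrow> T = U"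
    using finite_has_maximal2[OF fin ne] by auto
  have "S \<subseteq> cl T"
  proof
    fix x assume x: "x \<in> S"
    show "x \<in> cl T"
    proof (rule ccontr)
      assume n: "x \<notin> cl T"
      have "T = insert x T" using T(1) x by (intro T(3) indep_insert[OF T(2) n]) auto
      then show False using n cl_superset[of T] by blast
    qed
  qed
  then show ?thesis using that[OF T(1,2)] by blast
qed

text \<open>A maximal independent subset of \<open>S\<close> has the same closure as
  \<open>S\<close>, hence at least \<open>card B\<close> members. This moves independence from an
  unspecified set \<open>B\<close> of algebraic expressions to the generators themselves.\<close>

lemma indep_subset_of_generators:
  assumes "finite S" "finite B" "indep B" "B \<subseteq> cl S" "n \<le> card B"
  obtains T where "T \<subseteq> S" "indep T" "card T = n"
proof -
  obtain T where T: "T \<subseteq> S" "indep T" "S \<subseteq> cl T" by (rule indep_basis_exists[OF assms(1)])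
  have "finite T" using T assms(1) finite_subset by blast
  moreover have "B \<subseteq> cl T" using assms(4) cl_subset_cl[OF T(3)] by blast
  ultimately have "n \<le> card T" using indep_card_le[of T B] assms by simp
  then obtain U where "U \<subseteq> T" "card U = n" by (meson obtain_subset_with_card_n)
  then show ?thesis using that[of U] T(1) indep_subset[OF T(2)] by blast
qed

text \<open>Independence read along the tower \<open>gen\<close>: each entry is transcendental over
  the ring generated by the later ones, so that factoriality and injectivity can be carried up one
  generator at a time.\<close>

fun transc_list :: "'a list \<Rightarrow> bool" where
  "transc_list [] \<longleftrightarrow> True"
| "transc_list (t # ts) \<longleftrightarrow> transc_over (gen K ts) t \<and> transc_list ts"

lemma transc_list_if_indep: "distinct ts \<Longrightarrow> indep (set ts) \<Longrightarrow> transc_list ts"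
proof (induction ts)
  case (Cons t ts)
  have "t \<notin> cl (set ts)" using Cons.prems by (auto simp: indep_def)
  moreover have "indep (set ts)" using Cons.prems(2) by (rule indep_subset) auto
  ultimately show ?case using Cons by (simp add: transc_over_iff alg_closure_gen_eq_cl)
qed simp

lemma factorial_in_gen: "factorial_in K \<Longrightarrow> transc_list ts \<Longrightarrow> factorial_in (gen K ts)"
  by (induction ts) (auto intro: factorial_in_adjoin)

end

section \<open>Multivariate polynomials and transcendence degree\<close>

definition monom_val :: "('v \<Rightarrow> 'a::comm_semiring_1) \<Rightarrow> ('v \<Rightarrow>\<^sub>0 nat) \<Rightarrow> 'a" where
  "monom_val a m = (\<Prod>v\<in>Poly_Mapping.keys m. a v ^ Poly_Mapping.lookup m v)"

lemma monom_val_superset: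
  assumes "finite S" "Poly_Mapping.keys m \<subseteq> S"
  shows "monom_val a m = (\<Prod>v\<in>S. a v ^ Poly_Mapping.lookup m v)"
  unfolding monom_val_def using assms by (intro prod.mono_neutral_left) (auto simp: in_keys_iff)

lemma monom_val_add: "monom_val a (m + n) = monom_val a m * monom_val a n"
proof -
  let ?S = "Poly_Mapping.keys m \<union> Poly_Mapping.keys n"
  have "monom_val a (m + n) = (\<Prod>v\<in>?S. a v ^ Poly_Mapping.lookup (m + n) v)"
    by (rule monom_val_superset) (auto simp: keys_add)
  also have "\<dots> = monom_val a m * monom_val a n"
    by (simp add: monom_val_superset[of ?S] lookup_add power_add prod.distrib)
  finally show ?thesis .
qed

lemma monom_val_single: "monom_val a (Poly_Mapping.single v k) = a v ^ k"
  by (simp add: monom_val_def)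

lemma mpoly_eval_superset:
  assumes "finite S" "Poly_Mapping.keys p \<subseteq> S"
  shows "mpoly_eval a p = (\<Sum>m\<in>S. Poly_Mapping.lookup p m * monom_val a m)"
  unfolding mpoly_eval_def monom_val_def[symmetric]
  using assms by (intro sum.mono_neutral_left) (auto simp: in_keys_iff)

lemma mpoly_eval_add: "mpoly_eval a (p + q) = mpoly_eval a p + mpoly_eval a q"
proof -
  let ?S = "Poly_Mapping.keys p \<union> Poly_Mapping.keys q"
  have "mpoly_eval a (p + q) = (\<Sum>m\<in>?S. Poly_Mapping.lookup (p + q) m * monom_val a m)"
    by (rule mpoly_eval_superset) (auto simp: keys_add)
  also have "\<dots> = mpoly_eval a p + mpoly_eval a q"
    by (simp add: mpoly_eval_superset[of ?S] lookup_add distrib_right sum.distrib)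
  finally show ?thesis .
qed

lemma mpoly_eval_zero: "mpoly_eval a 0 = 0"
  by (simp add: mpoly_eval_def)

lemma mpoly_eval_sum: "mpoly_eval a (sum f I) = (\<Sum>i\<in>I. mpoly_eval a (f i))"
  by (induction I rule: infinite_finite_induct) (auto simp: mpoly_eval_zero mpoly_eval_add)

lemma mpoly_eval_single: "mpoly_eval a (Poly_Mapping.single m c) = c * monom_val a m"
  by (simp add: mpoly_eval_def monom_val_def)

text \<open>For a subring \<open>A\<close> and a set \<open>X\<close> of variables, these are the
  polynomials over which \<open>alg_independent\<close> quantifies.\<close>

definition mpolys_in :: "'a::comm_ring_1 set \<Rightarrow> 'v set \<Rightarrow> (('v \<Rightarrow>\<^sub>0 nat) \<Rightarrow>\<^sub>0 'a) set" where
  "mpolys_in A X = {p. (\<forall>m. Poly_Mapping.lookup p m \<in> A) \<and> (\<forall>m\<in>Poly_Mapping.keys p. Poly_Mapping.keys m \<subseteq> X)}"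

text \<open>The polynomials \<open>q i\<close> become the coefficients of the powers of one more
  variable \<open>t\<close>. If \<open>t\<close> is fresh, its exponent in a monomial reveals
  \<open>i\<close>, so no two terms merge and \<open>P = 0\<close> forces every coefficient to
  vanish.\<close>

lemma mpoly_from_coeffs:
  fixes q :: "nat \<Rightarrow> ('v \<Rightarrow>\<^sub>0 nat) \<Rightarrow>\<^sub>0 'a::comm_ring_1"
  assumes A: "is_subring A" and q: "\<And>i. q i \<in> mpolys_in A X"
  obtains P where "P \<in> mpolys_in A (insert t X)" "mpoly_eval a P = (\<Sum>i\<le>n. mpoly_eval a (q i) * a t ^ i)"
    "t \<notin> X \<Longrightarrow> P = 0 \<Longrightarrow> \<forall>i\<le>n. q i = 0"
proof -
  let ?s = "\<lambda>i. Poly_Mapping.single t i"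
  define P where "P = (\<Sum>i\<le>n. \<Sum>m\<in>Poly_Mapping.keys (q i). Poly_Mapping.single (m + ?s i) (Poly_Mapping.lookup (q i) m))"
  have qA: "Poly_Mapping.lookup (q i) m \<in> A" for i m using q by (simp add: mpolys_in_def)
  have qX: "Poly_Mapping.keys m \<subseteq> X" if "m \<in> Poly_Mapping.keys (q i)" for i m
    using q[of i] that by (simp add: mpolys_in_def)
  have lookP: "Poly_Mapping.lookup P k =
      (\<Sum>i\<le>n. \<Sum>m\<in>Poly_Mapping.keys (q i). if m + ?s i = k then Poly_Mapping.lookup (q i) m else 0)" for k
    by (simp add: P_def lookup_sum lookup_single when_def)
  have "Poly_Mapping.lookup P k \<in> A" for k
    unfolding lookP using qA is_subringD(1)[OF A] by (intro is_subring_sum[OF A]) auto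
  moreover have "Poly_Mapping.keys k \<subseteq> insert t X" if k: "k \<in> Poly_Mapping.keys P" for k
  proof -
    have "Poly_Mapping.lookup P k \<noteq> 0" using k by (simp add: in_keys_iff)
    then obtain i where "(\<Sum>m\<in>Poly_Mapping.keys (q i). if m + ?s i = k then Poly_Mapping.lookup (q i) m else 0) \<noteq> 0"
      unfolding lookP by (meson sum.neutral)
    then obtain m where "m \<in> Poly_Mapping.keys (q i)" "(if m + ?s i = k then Poly_Mapping.lookup (q i) m else 0) \<noteq> 0"
      by (rule sum.not_neutral_contains_not_neutral)
    then have m: "m \<in> Poly_Mapping.keys (q i)" "m + ?s i = k" by (auto split: if_splits)
    show ?thesis using keys_add[of m "?s i"] qX[OF m(1)] m(2) by (auto split: if_splits)
  qed
  ultimately have "P \<in> mpolys_in A (insert t X)" by (auto simp: mpolys_in_def)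
  moreover have "mpoly_eval a P = (\<Sum>i\<le>n. mpoly_eval a (q i) * a t ^ i)"
    unfolding P_def mpoly_eval_sum mpoly_eval_single monom_val_add monom_val_single
    by (simp add: mpoly_eval_superset[OF finite_keys order_refl] sum_distrib_right mult.assoc)
  moreover have "\<forall>i\<le>n. q i = 0" if t: "t \<notin> X" and P0: "P = 0"
  proof (intro allI impI poly_mapping_eqI)
    fix i m assume i: "i \<le> n"
    show "Poly_Mapping.lookup (q i) m = Poly_Mapping.lookup 0 m"
    proof (cases "m \<in> Poly_Mapping.keys (q i)")
      case False
      then show ?thesis by (simp add: in_keys_iff)
    next
      case True
      have z: "Poly_Mapping.lookup m' t = 0" if "m' \<in> Poly_Mapping.keys (q j)" for m' j
        using qX[OF that] t by (auto simp: in_keys_iff)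
      have eq: "m' + ?s j = m + ?s i \<longleftrightarrow> j = i \<and> m' = m" if "m' \<in> Poly_Mapping.keys (q j)" for m' j
      proof
        assume *: "m' + ?s j = m + ?s i"
        then have "Poly_Mapping.lookup (m' + ?s j) t = Poly_Mapping.lookup (m + ?s i) t" by simp
        then have "j = i" using z[OF that] z[OF True] by (simp add: lookup_add)
        then show "j = i \<and> m' = m" using * by simp
      qed simp
      have "0 = Poly_Mapping.lookup P (m + ?s i)" using P0 by simp
      also have "\<dots> = (\<Sum>j\<le>n. \<Sum>m'\<in>Poly_Mapping.keys (q j). if j = i \<and> m' = m then Poly_Mapping.lookup (q j) m' else 0)"
        unfolding lookP using eq by (intro sum.cong) auto
      also have "\<dots> = (\<Sum>j\<le>n. if j = i then (\<Sum>m'\<in>Poly_Mapping.keys (q j). if m' = m then Poly_Mapping.lookup (q j) m' else 0) else 0)"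
        by (intro sum.cong) auto
      also have "\<dots> = Poly_Mapping.lookup (q i) m" using i True by simp
      finally show ?thesis by simp
    qed
  qed
  ultimately show ?thesis using that by blast
qed

lemma gen_mpoly_eval:
  assumes A: "is_subring A"
  shows "y \<in> gen A ts \<Longrightarrow> \<exists>p\<in>mpolys_in A (set ts). mpoly_eval (\<lambda>v. v) p = y"
proof (induction ts arbitrary: y)
  case Nil
  then show ?case using is_subringD(1)[OF A]
    by (intro bexI[of _ "Poly_Mapping.single 0 y"])
       (auto simp: mpoly_eval_single monom_val_def mpolys_in_def lookup_single when_def)
next
  case (Cons t ts)
  then obtain p where p: "p \<in> polys_over (gen A ts)" "y = poly p t" by (auto simp: adjoin_def)
  then have "\<forall>i. \<exists>q. q \<in> mpolys_in A (set ts) \<and> mpoly_eval (\<lambda>v. v) q = coeff p i"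
    using Cons.IH by (fastforce simp: polys_over_def)
  then obtain q where q: "\<And>i. q i \<in> mpolys_in A (set ts)" "\<And>i. mpoly_eval (\<lambda>v. v) (q i) = coeff p i" by metis
  obtain P where "P \<in> mpolys_in A (insert t (set ts))"
    "mpoly_eval (\<lambda>v. v) P = (\<Sum>i\<le>degree p. mpoly_eval (\<lambda>v. v) (q i) * t ^ i)"
    by (rule mpoly_from_coeffs[where q = q and a = "\<lambda>v. v" and t = t and n = "degree p", OF A q(1)]) metis
  then show ?case using q(2) p(2) by (auto simp: poly_altdef)
qed

text \<open>The coefficients of \<open>p\<close> are values of multivariate polynomials in
  \<open>ts\<close>. Assembled with \<open>t\<close> as a further variable, these give a relation
  among independent elements, hence the zero polynomial; in particular the leading coefficient of
  \<open>p\<close> is zero.\<close>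

lemma transc_over_if_alg_independent:
  assumes A: "is_subring A" and ind: "alg_independent A (insert t (set ts))" and t: "t \<notin> set ts"
  shows "transc_over (gen A ts) t"
  unfolding transc_over_def
proof (intro ballI impI)
  fix p assume p: "p \<in> polys_over (gen A ts)" "poly p t = 0"
  then have "\<forall>i. \<exists>q. q \<in> mpolys_in A (set ts) \<and> mpoly_eval (\<lambda>v. v) q = coeff p i"
    using gen_mpoly_eval[OF A] by (fastforce simp: polys_over_def)
  then obtain q where q: "\<And>i. q i \<in> mpolys_in A (set ts)" "\<And>i. mpoly_eval (\<lambda>v. v) (q i) = coeff p i" by metis
  obtain P where P: "P \<in> mpolys_in A (insert t (set ts))"
    "mpoly_eval (\<lambda>v. v) P = (\<Sum>i\<le>degree p. mpoly_eval (\<lambda>v. v) (q i) * t ^ i)"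
    "t \<notin> set ts \<Longrightarrow> P = 0 \<Longrightarrow> \<forall>i\<le>degree p. q i = 0"
    by (rule mpoly_from_coeffs[where q = q and a = "\<lambda>v. v" and t = t and n = "degree p", OF A q(1)]) metis
  have "mpoly_eval (\<lambda>v. v) P = 0" using P(2) q(2) p(2) by (simp add: poly_altdef)
  then have "P = 0" using ind P(1) by (simp add: alg_independent_def mpolys_in_def)
  then have "q (degree p) = 0" using P(3) t by simp
  then have "lead_coeff p = 0" using q(2)[of "degree p"] by (simp add: mpoly_eval_zero)
  then show "p = 0" by simp
qed

context subring_of_field
begin

lemma indep_if_alg_independent:
  assumes "finite B" "alg_independent K B"
  shows "indep B"
  unfolding indep_def
proof
  fix b assume b: "b \<in> B"
  obtain ts where ts: "set ts = B - {b}" using assms(1) finite_list[of "B - {b}"] by auto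
  then have "transc_over (gen K ts) b"
    using assms(2) b by (intro transc_over_if_alg_independent K) (auto simp: insert_absorb)
  then show "b \<notin> cl (B - {b})" using ts by (simp add: transc_over_iff alg_closure_gen_eq_cl)
qed

text \<open>The inverse of \<open>x\<close> is the root of \<open>x X - 1\<close>, so a relatively
  algebraically closed subring is a field. This permits the comparison with
  \<open>field_adjoin\<close>.\<close>

lemma is_subfield_cl: "is_subfield (cl X)"
proof -
  have "inverse x \<in> cl X" if x: "x \<in> cl X" for x
  proof (cases "x = 0")
    case False
    have "[:- 1, x:] \<in> polys_over (cl X)"
      using x is_subringD(1,2,5)[OF is_subring_cl[of X]] is_subringD(1)[OF is_subring_polys_over[OF is_subring_cl[of X]]]
      by (simp add: pCons_in_polys_over_iff)
    moreover have "poly [:- 1, x:] (inverse x) = 0" using False by simp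
    moreover have "[:- 1, x:] \<noteq> 0" by simp
    ultimately have "inverse x \<in> alg_closure (cl X)" unfolding alg_closure_def by blast
    then show ?thesis using cl_closed by (auto simp: alg_closed_in_def)
  qed (use x in simp)
  then show ?thesis using is_subringD[OF is_subring_cl[of X]] by (simp add: is_subfield_def)
qed

lemma field_adjoin_subset_cl: "field_adjoin K X \<subseteq> cl X"
  unfolding field_adjoin_def using cl_superset is_subfield_cl by (rule hull_minimal)

end

section \<open>Algebraic numbers and the application of Schanuel's conjecture\<close>

lemma is_subring_Qbar: "is_subring Qbar"
  using algebraic_mult[of "- 1"] by (auto simp: is_subring_def Qbar_def algebraic_add algebraic_mult)

interpretation Qbar: subring_of_field Qbar
  by unfold_locales (rule is_subring_Qbar)

lemma factorial_in_Qbar: "factorial_in Qbar"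
proof (rule factorial_in_subfield[OF is_subring_Qbar])
  fix x assume "x \<in> Qbar" "x \<noteq> 0"
  then show "\<exists>y\<in>Qbar. x * y = 1"
    by (intro bexI[of _ "inverse x"]) (auto simp: Qbar_def algebraic_inverse)
qed

text \<open>Multiplication by \<open>c\<close> is an automorphism of the rational vector space. It
  is applied with \<open>c = \<xi>\<close> to prepare Schanuel's conjecture, and with the reciprocal
  of a common denominator in \<open>integer_basis\<close>.\<close>

lemma rat_independent_scale:
  fixes B :: "complex set"
  assumes "finite B" "rat_vs.independent B" "c \<noteq> 0"
  shows "rat_vs.independent ((\<lambda>z. z * c) ` B)"
proof
  have inj: "inj_on (\<lambda>z. z * c) B" using assms(3) by (auto simp: inj_on_def)
  assume "rat_vs.dependent ((\<lambda>z. z * c) ` B)"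
  then obtain u where u: "\<exists>v\<in>(\<lambda>z. z * c) ` B. u v \<noteq> 0" "(\<Sum>v\<in>(\<lambda>z. z * c) ` B. of_rat (u v) * v) = 0"
    using assms(1) by (subst (asm) rat_vs.dependent_finite) auto
  have "(\<Sum>v\<in>B. of_rat (u (v * c)) * v) * c = 0"
    using u(2) inj by (simp add: sum.reindex sum_distrib_right mult.assoc)
  then have "(\<Sum>v\<in>B. of_rat (u (v * c)) * v) = 0" using assms(3) by simp
  moreover have "\<exists>v\<in>B. u (v * c) \<noteq> 0" using u(1) by auto
  ultimately have "rat_vs.dependent B"
    using assms(1) by (subst rat_vs.dependent_finite) (auto intro!: exI[of _ "\<lambda>v. u (v * c)"])
  then show False using assms(2) by simp
qed

text \<open>The transcendence degree is a supremum of natural numbers; if all of them were below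
  \<open>n\<close>, they would be bounded by \<open>n - 1\<close>. The assumption
  \<open>n > 0\<close> makes this a genuine predecessor.\<close>

lemma trdeg_ge_obtain:
  assumes "enat n \<le> trdeg K L" "n > 0"
  obtains B where "finite B" "B \<subseteq> L" "alg_independent K B" "n \<le> card B"
proof -
  have "\<exists>B. finite B \<and> B \<subseteq> L \<and> alg_independent K B \<and> n \<le> card B"
  proof (rule ccontr)
    assume *: "\<nexists>B. finite B \<and> B \<subseteq> L \<and> alg_independent K B \<and> n \<le> card B"
    have "trdeg K L \<le> enat (n - 1)" unfolding trdeg_def
    proof (rule SUP_least)
      fix B assume "B \<in> {B. finite B \<and> B \<subseteq> L \<and> alg_independent K B}"
      then have "\<not> n \<le> card B" using * by blast
      then show "enat (card B) \<le> enat (n - 1)" by simp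
    qed
    then have "enat n \<le> enat (n - 1)" using assms(1) order_trans by blast
    then show False using assms(2) by simp
  qed
  then show ?thesis using that by blast
qed

lemma schanuel_transcendence_basis:
  assumes "schanuel_conjecture" and "\<xi> \<noteq> 0"
    and \<beta>: "inj_on \<beta> {1..n::nat}" "rat_vs.independent (\<beta> ` {1..n})" "\<And>i. i \<in> {1..n} \<Longrightarrow> algebraic (\<beta> i)"
  obtains T where "T \<subseteq> insert \<xi> ((\<lambda>i. exp (\<beta> i * \<xi>)) ` {1..n})" "Qbar.indep T" "card T = n"
proof (cases "n = 0")
  case True
  show ?thesis by (rule that[of "{}"]) (simp_all add: True Qbar.indep_def)
next
  case False
  define S where "S = insert \<xi> ((\<lambda>i. exp (\<beta> i * \<xi>)) ` {1..n})"
  define x where "x = (\<lambda>i. \<beta> i * \<xi>)"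
  define L where "L = field_adjoin Qbar (x ` {1..n} \<union> (\<lambda>i. exp (x i)) ` {1..n})"
  have "inj_on x {1..n}"
    using \<beta>(1) \<open>\<xi> \<noteq> 0\<close> unfolding inj_on_def x_def by (metis mult_right_cancel)
  moreover have "x ` {1..n} = (\<lambda>z. z * \<xi>) ` (\<beta> ` {1..n})" by (auto simp: x_def)
  then have "rat_vs.independent (x ` {1..n})" using rat_independent_scale[OF _ \<beta>(2) \<open>\<xi> \<noteq> 0\<close>] by simp
  ultimately have "enat n \<le> trdeg Qbar L" using assms(1) unfolding schanuel_conjecture_def L_def by blast
  then obtain B where B: "finite B" "B \<subseteq> L" "alg_independent Qbar B" "n \<le> card B"
    using trdeg_ge_obtain[of n Qbar L] False by blast
  \<comment> \<open>As the \<open>\<beta> i\<close> are algebraic, each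
    \<open>\<beta> i * \<xi>\<close> is algebraic over \<open>\<xi>\<close>: the 2n generators of
    Schanuel's field cost only the n + 1 elements of \<open>S\<close>.\<close>
  have "x ` {1..n} \<union> (\<lambda>i. exp (x i)) ` {1..n} \<subseteq> Qbar.cl S"
  proof -
    have "\<beta> i \<in> Qbar.cl S" if "i \<in> {1..n}" for i
      using Qbar.cl_superset[of S] \<beta>(3)[OF that] by (auto simp: Qbar_def)
    moreover have "S \<subseteq> Qbar.cl S" using Qbar.cl_superset[of S] by blast
    ultimately show ?thesis
      using is_subringD(4)[OF Qbar.is_subring_cl[of S]] by (auto simp: x_def S_def)
  qed
  then have "L \<subseteq> Qbar.cl S"
    unfolding L_def by (intro order_trans[OF Qbar.field_adjoin_subset_cl Qbar.cl_subset_cl])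
  then have BS: "B \<subseteq> Qbar.cl S" using B(2) by blast
  have fS: "finite S" by (simp add: S_def)
  show ?thesis
    using Qbar.indep_subset_of_generators[OF fS B(1) Qbar.indep_if_alg_independent[OF B(1,3)] BS B(4)] that
    unfolding S_def by blast
qed

section \<open>The kernel of an evaluation\<close>

text \<open>The source is assumed to be a commutative ring only. Factorization takes place in the
  image, a subring of a field, and is pulled back wherever the map is injective.\<close>

locale comm_ring_hom_to_field =
  fixes ev :: "'b::comm_ring_1 \<Rightarrow> 'a::field"
  assumes ev_0: "ev 0 = 0" and ev_1: "ev 1 = 1"
    and ev_add: "ev (x + y) = ev x + ev y" and ev_mult: "ev (x * y) = ev x * ev y"
begin

lemma ev_sum: "ev (sum f I) = (\<Sum>i\<in>I. ev (f i))"
  by (induction I rule: infinite_finite_induct) (auto simp: ev_0 ev_add)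

lemma ev_diff: "ev (x - y) = ev x - ev y"
  using ev_add[of "x - y" y] by simp

lemma ev_poly: "ev (poly p x) = poly (map_poly ev p) (ev x)"
  by (induction p) (auto simp: ev_0 ev_add ev_mult map_poly_pCons)

lemma map_poly_ev_mult: "map_poly ev (p * q) = map_poly ev p * map_poly ev q"
  by (intro poly_eqI) (simp add: coeff_map_poly ev_0 coeff_mult ev_sum ev_mult)

lemma is_subring_ev_image: "is_subring B \<Longrightarrow> is_subring (ev ` B)"
  by (rule is_subring_image) (auto simp: ev_0 ev_1 ev_add ev_mult)

lemma polys_over_ev_image:
  assumes "is_subring B"
  shows "polys_over (ev ` B) = map_poly ev ` polys_over B"
proof
  show "map_poly ev ` polys_over B \<subseteq> polys_over (ev ` B)"
    by (auto simp: polys_over_def coeff_map_poly ev_0)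
  show "polys_over (ev ` B) \<subseteq> map_poly ev ` polys_over B"
  proof
    fix p assume "p \<in> polys_over (ev ` B)"
    then have "\<forall>i. \<exists>b. b \<in> B \<and> coeff p i = ev b" unfolding polys_over_def by blast
    then obtain b where b: "\<And>i. b i \<in> B" "\<And>i. coeff p i = ev (b i)" by metis
    \<comment> \<open>The sum stops at \<open>degree p\<close> because the chosen preimages of 0
      need not be 0.\<close>
    define q where "q = (\<Sum>i\<le>degree p. monom (b i) i)"
    have cq: "coeff q i = (if i \<le> degree p then b i else 0)" for i by (simp add: q_def coeff_sum)
    have "map_poly ev q = p"
      by (intro poly_eqI) (auto simp: coeff_map_poly ev_0 cq coeff_eq_0 simp flip: b(2))
    moreover have "q \<in> polys_over B" using b cq is_subringD(1)[OF assms] by (simp add: polys_over_def)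
    ultimately show "p \<in> map_poly ev ` polys_over B" by blast
  qed
qed

lemma ev_image_adjoin: "is_subring B \<Longrightarrow> ev ` adjoin B s = adjoin (ev ` B) (ev s)"
  by (simp add: adjoin_def polys_over_ev_image image_image ev_poly)

lemma ev_image_gen: "is_subring B \<Longrightarrow> ev ` gen B ss = gen (ev ` B) (map ev ss)"
  by (induction ss) (auto simp: ev_image_adjoin is_subring_gen)

lemma inj_on_map_poly_ev:
  assumes "inj_on ev B"
  shows "inj_on (map_poly ev) (polys_over B)"
proof (rule inj_onI, rule poly_eqI)
  fix p q i assume "p \<in> polys_over B" "q \<in> polys_over B" and eq: "map_poly ev p = map_poly ev q"
  then have "coeff p i \<in> B" "coeff q i \<in> B" by (auto simp: polys_over_def)
  moreover have "ev (coeff p i) = ev (coeff q i)" using arg_cong[OF eq, of "\<lambda>p. coeff p i"] by (simp add: coeff_map_poly ev_0)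
  ultimately show "coeff p i = coeff q i" using assms by (auto dest: inj_onD)
qed

text \<open>If \<open>p\<close> and \<open>q\<close> represent elements with equal values, the image
  of \<open>p - q\<close> is a polynomial relation for the transcendental \<open>ev s\<close>. It is
  therefore zero, and \<open>p = q\<close> by injectivity on \<open>B\<close>.\<close>

lemma inj_on_ev_adjoin:
  assumes B: "is_subring B" "inj_on ev B" and s: "transc_over (ev ` B) (ev s)"
  shows "inj_on ev (adjoin B s)"
proof (rule inj_onI)
  fix x y assume "x \<in> adjoin B s" "y \<in> adjoin B s" and eq: "ev x = ev y"
  then obtain p q where pq: "p \<in> polys_over B" "q \<in> polys_over B" "x = poly p s" "y = poly q s" by (auto simp: adjoin_def)
  have d: "p - q \<in> polys_over B" "0 \<in> polys_over B"
    using pq is_subringD[OF is_subring_polys_over[OF B(1)]] by auto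
  have "poly (map_poly ev (p - q)) (ev s) = 0" using eq pq by (simp add: ev_diff flip: ev_poly)
  moreover have "map_poly ev (p - q) \<in> polys_over (ev ` B)" using d polys_over_ev_image[OF B(1)] by blast
  ultimately have "map_poly ev (p - q) = map_poly ev 0" using s by (simp add: transc_over_def)
  then have "p - q = 0" using inj_on_map_poly_ev[OF B(2)] d by (metis inj_onD)
  then show "x = y" using pq by simp
qed

lemma inj_on_ev_gen:
  assumes B: "is_subring B" "inj_on ev B"
  shows "subring_of_field.transc_list (ev ` B) (map ev ss) \<Longrightarrow> inj_on ev (gen B ss)"
proof (induction ss)
  case (Cons s ss)
  interpret subring_of_field "ev ` B" by unfold_locales (rule is_subring_ev_image[OF B(1)])
  show ?case using Cons by (auto intro!: inj_on_ev_adjoin is_subring_gen B(1) simp: ev_image_gen B(1))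
qed (simp add: B)

lemma kernel_principal:
  assumes B: "is_subring B" "inj_on ev B" "factorial_in (ev ` B)"
    and ss: "subring_of_field.transc_list (ev ` B) (map ev ss)"
    and h: "h \<in> adjoin (gen B ss) s" "h \<noteq> 0" "ev h = 0"
  obtains g where "ev g = 0" "\<And>f. f \<in> adjoin (gen B ss) s \<Longrightarrow> ev f = 0 \<Longrightarrow> g dvd f"
proof -
  interpret subring_of_field "ev ` B" by unfold_locales (rule is_subring_ev_image[OF B(1)])
  let ?C = "gen B ss"
  have C: "is_subring ?C" by (rule is_subring_gen[OF B(1)])
  note P = is_subring_polys_over[OF C]
  have fac: "factorial_in (ev ` ?C)"
    using factorial_in_gen[OF B(3) ss] by (simp add: ev_image_gen B(1))
  have inj: "inj_on (map_poly ev) (polys_over ?C)"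
    by (intro inj_on_map_poly_ev inj_on_ev_gen B(1,2) ss)
  obtain p0 where p0: "p0 \<in> polys_over ?C" "h = poly p0 s" using h(1) by (auto simp: adjoin_def)
  have "map_poly ev p0 \<in> polys_over (ev ` ?C)" using p0(1) polys_over_ev_image[OF C] by blast
  \<comment> \<open>The element \<open>h\<close> supplies the nonzero vanishing polynomial with
    which the ideal argument starts; injectivity on the coefficients keeps its image
    nonzero.\<close>
  moreover have "map_poly ev p0 \<noteq> 0"
  proof
    assume "map_poly ev p0 = 0"
    then have "map_poly ev p0 = map_poly ev 0" by simp
    then have "p0 = 0" using inj p0(1) is_subringD(1)[OF P] by (metis inj_onD)
    then show False using h(2) p0(2) by simp
  qed
  moreover have "poly (map_poly ev p0) (ev s) = 0" using h(3) p0(2) by (simp flip: ev_poly)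
  ultimately obtain G where G: "G \<in> polys_over (ev ` ?C)" "poly G (ev s) = 0"
    "\<And>p. p \<in> polys_over (ev ` ?C) \<Longrightarrow> poly p (ev s) = 0 \<Longrightarrow> dvd_in (polys_over (ev ` ?C)) G p"
    using vanishing_ideal_principal[OF fac, of "map_poly ev p0" "ev s"] by blast
  obtain g where g: "g \<in> polys_over ?C" "G = map_poly ev g" using G(1) polys_over_ev_image[OF C] by blast
  show ?thesis
  proof (rule that)
    show "ev (poly g s) = 0" using G(2) g(2) by (simp add: ev_poly)
    fix f assume "f \<in> adjoin ?C s" and f0: "ev f = 0"
    then obtain p where p: "p \<in> polys_over ?C" "f = poly p s" by (auto simp: adjoin_def)
    have "map_poly ev p \<in> polys_over (ev ` ?C)" using p(1) polys_over_ev_image[OF C] by blast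
    moreover have "poly (map_poly ev p) (ev s) = 0" using f0 p(2) by (simp flip: ev_poly)
    ultimately have "dvd_in (polys_over (ev ` ?C)) G (map_poly ev p)" by (rule G(3))
    then obtain Q where "Q \<in> polys_over (ev ` ?C)" "map_poly ev p = G * Q" unfolding dvd_in_def by blast
    then obtain q where q: "q \<in> polys_over ?C" "map_poly ev p = map_poly ev (g * q)"
      using polys_over_ev_image[OF C] g(2) by (auto simp: map_poly_ev_mult)
    \<comment> \<open>The factorization is pulled back as an identity of polynomials, so it survives
      the substitution of \<open>s\<close>.\<close>
    then have "p = g * q" using inj p(1) g(1) is_subringD(4)[OF P] by (metis inj_onD)
    then show "poly g s dvd f" using p(2) by simp
  qed
qed

end

section \<open>Exponential polynomials\<close>

lemma exp_eval_ring:
  "exp_eval 0 x = 0" "exp_eval 1 x = 1" "exp_eval (f + g) x = exp_eval f x + exp_eval g x"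
  "exp_eval (f * g) x = exp_eval f x * exp_eval g x"
  by (simp_all add: zero_exp_poly.rep_eq one_exp_poly.rep_eq plus_exp_poly.rep_eq times_exp_poly.rep_eq)

lemma exp_eval_sum: "exp_eval (sum f I) x = (\<Sum>i\<in>I. exp_eval (f i) x)"
  by (induction I rule: infinite_finite_induct) (auto simp: exp_eval_ring)

lemma exp_eval_prod: "exp_eval (prod f I) x = (\<Prod>i\<in>I. exp_eval (f i) x)"
  by (induction I rule: infinite_finite_induct) (auto simp: exp_eval_ring)

lemma exp_eval_power: "exp_eval (f ^ n) x = exp_eval f x ^ n"
  by (induction n) (auto simp: exp_eval_ring)

lemma exp_poly_eqI: "(\<And>x. exp_eval f x = exp_eval g x) \<Longrightarrow> f = g"
  by (simp add: exp_eval_inject[symmetric] fun_eq_iff)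

text \<open>\<open>Abs_exp_poly\<close> is meaningful only on exponential polynomials, so evaluation
  facts about \<open>ep_const\<close> and \<open>ep_exp\<close> are guarded by algebraicity of the
  argument.\<close>

definition ep_const :: "complex \<Rightarrow> exp_poly" where
  "ep_const c = Abs_exp_poly (\<lambda>_. c)"

definition ep_id :: exp_poly where
  "ep_id = Abs_exp_poly (\<lambda>x. x)"

definition ep_exp :: "complex \<Rightarrow> exp_poly" where
  "ep_exp b = Abs_exp_poly (\<lambda>x. exp (b * x))"

lemma exp_eval_const: "algebraic c \<Longrightarrow> exp_eval (ep_const c) x = c"
  by (simp add: ep_const_def Abs_exp_poly_inverse is_exp_poly_const)

lemma exp_eval_id: "exp_eval ep_id x = x"
proof -
  have "is_exp_poly (\<lambda>x. x)"
    by (rule is_exp_polyI[of "{()}" "\<lambda>_. [:0, 1:]" "\<lambda>_. 0"]) (auto simp: coeff_pCons split: nat.splits)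
  then show ?thesis by (simp add: ep_id_def Abs_exp_poly_inverse)
qed

lemma exp_eval_exp: "algebraic b \<Longrightarrow> exp_eval (ep_exp b) x = exp (b * x)"
proof -
  assume "algebraic b"
  then have "is_exp_poly (\<lambda>x. exp (b * x))"
    by (intro is_exp_polyI[of "{()}" "\<lambda>_. 1" "\<lambda>_. b"]) auto
  then show ?thesis by (simp add: ep_exp_def Abs_exp_poly_inverse)
qed

lemma algebraic_uminus: "algebraic (c :: complex) \<Longrightarrow> algebraic (- c)"
  using algebraic_mult[of "- 1" c] by simp

lemma ep_exp_dvd_one: "algebraic b \<Longrightarrow> ep_exp b dvd 1"
proof
  assume "algebraic b"
  then show "1 = ep_exp b * ep_exp (- b)"
    by (intro exp_poly_eqI) (simp add: exp_eval_ring exp_eval_exp algebraic_uminus flip: exp_add)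
qed

lemma is_subring_ep_const: "is_subring (ep_const ` Qbar)"
proof (rule is_subring_image[OF is_subring_Qbar])
  fix x y assume "x \<in> Qbar" "y \<in> Qbar"
  then have "algebraic x" "algebraic y" by (auto simp: Qbar_def)
  then show "ep_const (x + y) = ep_const x + ep_const y" "ep_const (x * y) = ep_const x * ep_const y"
    by (auto intro!: exp_poly_eqI simp: exp_eval_ring exp_eval_const algebraic_add algebraic_mult)
qed (auto intro!: exp_poly_eqI simp: exp_eval_ring exp_eval_const)

section \<open>Exponents as integer combinations of an independent family\<close>

lemma common_denominator:
  fixes Q :: "rat set"
  assumes "finite Q"
  obtains D :: int where "D > 0" "\<And>q. q \<in> Q \<Longrightarrow> \<exists>k. q = of_int k / of_int D"
  using assms
proof (induction Q arbitrary: thesis)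
  case empty
  show ?case by (rule empty[of 1]) auto
next
  case (insert q Q)
  obtain D where D: "D > 0" "\<And>q. q \<in> Q \<Longrightarrow> \<exists>k. q = of_int k / of_int D" using insert.IH by blast
  obtain a b where ab: "q = of_int a / of_int b" "b > 0"
    by (metis Fract_of_int_quotient Rat_cases)
  show ?case
  proof (rule insert.prems[of "D * b"])
    show "D * b > 0" using D ab by simp
    fix r assume "r \<in> insert q Q"
    then show "\<exists>k. r = of_int k / of_int (D * b)"
    proof
      assume "r = q"
      then have "r = of_int (a * D) / of_int (D * b)" using ab D by (simp add: field_simps)
      then show ?thesis ..
    next
      assume "r \<in> Q"
      then obtain k where "r = of_int k / of_int D" using D by blast
      then have "r = of_int (k * b) / of_int (D * b)" using ab D by (simp add: field_simps)
      then show ?thesis ..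
    qed
  qed
qed

text \<open>A rational basis of the span is chosen inside \<Gamma>, so that it is algebraic.
  Dividing it by a common denominator of all coordinates makes the coordinates integers.\<close>

lemma integer_basis:
  fixes \<Gamma> :: "complex set"
  assumes "finite \<Gamma>" "\<And>\<gamma>. \<gamma> \<in> \<Gamma> \<Longrightarrow> algebraic \<gamma>"
  obtains n :: nat and \<beta> where "inj_on \<beta> {1..n}" "rat_vs.independent (\<beta> ` {1..n})"
    "\<And>i. i \<in> {1..n} \<Longrightarrow> algebraic (\<beta> i)"
    "\<And>\<gamma>. \<gamma> \<in> \<Gamma> \<Longrightarrow> \<exists>k :: nat \<Rightarrow> int. \<gamma> = (\<Sum>i=1..n. of_int (k i) * \<beta> i)"
proof -
  obtain B where B: "B \<subseteq> \<Gamma>" "rat_vs.independent B" "\<Gamma> \<subseteq> rat_vs.span B"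
    by (rule rat_vs.maximal_independent_subset)
  have fB: "finite B" using B(1) assms(1) finite_subset by blast
  have "\<forall>\<gamma>\<in>\<Gamma>. \<exists>r. \<gamma> = (\<Sum>b\<in>B. of_rat (r b) * b)"
    using B(3) unfolding rat_vs.span_finite[OF fB] by blast
  then obtain r where r: "\<And>\<gamma>. \<gamma> \<in> \<Gamma> \<Longrightarrow> \<gamma> = (\<Sum>b\<in>B. of_rat (r \<gamma> b) * b)" by metis
  have "finite ((\<lambda>(\<gamma>, b). r \<gamma> b) ` (\<Gamma> \<times> B))" using assms(1) fB by simp
  then obtain D where D: "D > 0" "\<And>q. q \<in> (\<lambda>(\<gamma>, b). r \<gamma> b) ` (\<Gamma> \<times> B) \<Longrightarrow> \<exists>k. q = of_int k / of_int D"
    by (rule common_denominator) blast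
  have "\<forall>\<gamma> b. \<exists>k. \<gamma> \<in> \<Gamma> \<and> b \<in> B \<longrightarrow> r \<gamma> b = of_int k / of_int D" using D(2) by fastforce
  then obtain k where k: "\<And>\<gamma> b. \<gamma> \<in> \<Gamma> \<Longrightarrow> b \<in> B \<Longrightarrow> r \<gamma> b = of_int (k \<gamma> b) / of_int D" by metis
  obtain e where e: "bij_betw e {1..card B} B" using ex_bij_betw_nat_finite_1[OF fB] by auto
  define c :: complex where "c = 1 / of_int D"
  have c: "c \<noteq> 0" "algebraic c" using D(1) by (auto simp: c_def divide_inverse algebraic_inverse)
  define \<beta> where "\<beta> = (\<lambda>i. e i * c)"
  show ?thesis
  proof (rule that)
    show "inj_on \<beta> {1..card B}"
      using e c(1) unfolding bij_betw_def inj_on_def \<beta>_def by (metis mult_right_cancel)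
    have "e ` {1..card B} = B" using e by (simp add: bij_betw_def)
    then have "\<beta> ` {1..card B} = (\<lambda>z. z * c) ` B"
      unfolding \<beta>_def by (subst image_image[symmetric]) simp
    then show "rat_vs.independent (\<beta> ` {1..card B})" using rat_independent_scale[OF fB B(2) c(1)] by simp
    show "algebraic (\<beta> i)" if "i \<in> {1..card B}" for i
    proof -
      have "e i \<in> B" using that e by (rule bij_betwE[rule_format, rotated])
      then show ?thesis unfolding \<beta>_def using B(1) assms(2) c(2) by (intro algebraic_mult) auto
    qed
    fix \<gamma> assume \<gamma>: "\<gamma> \<in> \<Gamma>"
    have "\<gamma> = (\<Sum>b\<in>B. of_int (k \<gamma> b) * (b * c))"
      by (subst r[OF \<gamma>], rule sum.cong) (simp_all add: k[OF \<gamma>] c_def of_rat_divide)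
    also have "\<dots> = (\<Sum>i=1..card B. of_int (k \<gamma> (e i)) * \<beta> i)"
      unfolding \<beta>_def by (rule sum.reindex_bij_betw[OF e, symmetric])
    finally show "\<exists>k :: nat \<Rightarrow> int. \<gamma> = (\<Sum>i=1..card B. of_int (k i) * \<beta> i)"
      by (rule exI[of _ "\<lambda>i. k \<gamma> (e i)"])
  qed
qed

text \<open>Keeps the exponents visible, so that \<open>f\<close> and \<open>h\<close> can be
  expanded over one common finite set.\<close>

definition has_exponents :: "exp_poly \<Rightarrow> complex set \<Rightarrow> bool" where
  "has_exponents f \<Gamma> \<longleftrightarrow> (\<exists>(N::nat) P \<gamma>. (\<forall>i\<in>{1..N}. (\<forall>k. algebraic (coeff (P i) k)) \<and> \<gamma> i \<in> \<Gamma>) \<and>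
     (\<forall>x. exp_eval f x = (\<Sum>i=1..N. poly (P i) x * exp (\<gamma> i * x))))"

lemma has_exponents_obtain:
  obtains \<Gamma> where "finite \<Gamma>" "\<And>\<gamma>. \<gamma> \<in> \<Gamma> \<Longrightarrow> algebraic \<gamma>" "has_exponents f \<Gamma>"
proof -
  have "is_exp_poly (exp_eval f)" using exp_eval by blast
  then obtain N :: nat and P \<gamma> where *: "\<forall>i\<in>{1..N}. (\<forall>k. algebraic (coeff (P i) k)) \<and> algebraic (\<gamma> i)"
    "\<forall>x. exp_eval f x = (\<Sum>i=1..N. poly (P i) x * exp (\<gamma> i * x))"
    unfolding is_exp_poly_def by blast
  have "has_exponents f (\<gamma> ` {1..N})" unfolding has_exponents_def using * by (intro exI[of _ N] exI[of _ P] exI[of _ \<gamma>]) auto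
  then show ?thesis using that[of "\<gamma> ` {1..N}"] *(1) by auto
qed

lemma has_exponents_mono: "has_exponents f \<Gamma> \<Longrightarrow> \<Gamma> \<subseteq> \<Delta> \<Longrightarrow> has_exponents f \<Delta>"
  unfolding has_exponents_def by (meson subsetD)

text \<open>The integer coordinates of the exponents may be negative, and \<open>R\<close> need not
  contain inverses of the exponentials. Multiplication by the unit \<open>ep_exp c\<close> raises
  every coordinate by the same \<open>M\<close> and leaves only nonnegative powers.\<close>

lemma mult_exp_in_subring:
  assumes R: "is_subring R" "ep_const ` Qbar \<subseteq> R" "ep_id \<in> R" "\<And>i. i \<in> {1..n::nat} \<Longrightarrow> ep_exp (\<beta> i) \<in> R"
    and \<beta>: "\<And>i. i \<in> {1..n} \<Longrightarrow> algebraic (\<beta> i)"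
    and \<Gamma>: "\<And>\<gamma>. \<gamma> \<in> \<Gamma> \<Longrightarrow> \<exists>k :: nat \<Rightarrow> int. \<gamma> = (\<Sum>i=1..n. of_int (k i) * \<beta> i)"
    and f: "has_exponents f \<Gamma>"
  obtains c where "algebraic c" "f * ep_exp c \<in> R"
proof -
  obtain N :: nat and P \<gamma> where f': "\<And>i k. i \<in> {1..N} \<Longrightarrow> algebraic (coeff (P i) k)" "\<And>i. i \<in> {1..N} \<Longrightarrow> \<gamma> i \<in> \<Gamma>"
    "\<And>x. exp_eval f x = (\<Sum>i=1..N. poly (P i) x * exp (\<gamma> i * x))"
    using f unfolding has_exponents_def by blast
  have "\<forall>i. \<exists>k :: nat \<Rightarrow> int. i \<in> {1..N} \<longrightarrow> \<gamma> i = (\<Sum>j=1..n. of_int (k j) * \<beta> j)" using \<Gamma> f'(2) by blast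
  then obtain k :: "nat \<Rightarrow> nat \<Rightarrow> int" where k: "\<And>i. i \<in> {1..N} \<Longrightarrow> \<gamma> i = (\<Sum>j=1..n. of_int (k i j) * \<beta> j)" by metis
  \<comment> \<open>Bounds every \<open>\<bar>k i j\<bar>\<close>, so \<open>k i j + M\<close> is
    nonnegative and passing to \<open>nat\<close> loses nothing.\<close>
  define M where "M = (\<Sum>i=1..N. \<Sum>j=1..n. \<bar>k i j\<bar>)"
  have kM: "k i j + M \<ge> 0" if "i \<in> {1..N}" "j \<in> {1..n}" for i j
  proof -
    have "\<bar>k i j\<bar> \<le> (\<Sum>j=1..n. \<bar>k i j\<bar>)" using that by (intro member_le_sum) auto
    also have "\<dots> \<le> M" unfolding M_def using that by (intro member_le_sum) (auto intro: sum_nonneg)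
    finally show ?thesis by linarith
  qed
  define c where "c = (\<Sum>j=1..n. of_int M * \<beta> j)"
  have c: "algebraic c" unfolding c_def using \<beta> by (intro algebraic_sum algebraic_mult) auto
  define F where "F = (\<Sum>i=1..N. (\<Sum>l\<le>degree (P i). ep_const (coeff (P i) l) * ep_id ^ l) * (\<Prod>j=1..n. ep_exp (\<beta> j) ^ nat (k i j + M)))"
  have "F \<in> R"
    unfolding F_def using R f'(1)
    by (intro is_subring_sum is_subringD(4) is_subring_prod is_subring_power) (auto simp: Qbar_def)
  moreover have "f * ep_exp c = F"
  proof (rule exp_poly_eqI)
    fix x
    have "exp_eval (\<Prod>j=1..n. ep_exp (\<beta> j) ^ nat (k i j + M)) x = exp (\<gamma> i * x) * exp (c * x)"
      if i: "i \<in> {1..N}" for i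
    proof -
      have "exp_eval (\<Prod>j=1..n. ep_exp (\<beta> j) ^ nat (k i j + M)) x = (\<Prod>j=1..n. exp (\<beta> j * x) ^ nat (k i j + M))"
        unfolding exp_eval_prod exp_eval_power using \<beta> by (intro prod.cong) (auto simp: exp_eval_exp)
      also have "\<dots> = (\<Prod>j=1..n. exp (of_int (k i j + M) * (\<beta> j * x)))"
      proof (rule prod.cong)
        fix j assume "j \<in> {1..n}"
        then have "of_nat (nat (k i j + M)) = (of_int (k i j + M) :: complex)" using kM[OF i] by (simp add: of_nat_nat)
        then show "exp (\<beta> j * x) ^ nat (k i j + M) = exp (of_int (k i j + M) * (\<beta> j * x))"
          by (metis exp_of_nat_mult)
      qed simp
      also have "\<dots> = exp (\<Sum>j=1..n. of_int (k i j + M) * (\<beta> j * x))" by (simp add: exp_sum)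
      also have "(\<Sum>j=1..n. of_int (k i j + M) * (\<beta> j * x)) = \<gamma> i * x + c * x"
        unfolding k[OF i] c_def sum_distrib_right sum.distrib[symmetric]
        by (intro sum.cong) (simp_all add: algebra_simps)
      finally show ?thesis by (simp add: exp_add)
    qed
    moreover have "exp_eval (\<Sum>l\<le>degree (P i). ep_const (coeff (P i) l) * ep_id ^ l) x = poly (P i) x" if "i \<in> {1..N}" for i
      unfolding poly_altdef exp_eval_sum exp_eval_ring exp_eval_power exp_eval_id
      using f'(1)[OF that] by (simp add: exp_eval_const)
    ultimately have "exp_eval F x = (\<Sum>i=1..N. poly (P i) x * (exp (\<gamma> i * x) * exp (c * x)))"
      unfolding F_def exp_eval_sum[of _ "{1..N}"] by (intro sum.cong) (auto simp: exp_eval_ring)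
    then show "exp_eval (f * ep_exp c) x = exp_eval F x"
      by (simp add: exp_eval_ring exp_eval_exp[OF c] f'(3) sum_distrib_right mult.assoc)
  qed
  ultimately show ?thesis using that[OF c] by simp
qed

theorem theorem5:
  fixes \<xi> :: complex and h :: exp_poly
  assumes "schanuel_conjecture"
    and "\<xi> \<noteq> 0"
    and "irreducible h"
    and "exp_eval h \<xi> = 0"
  shows "\<forall>f :: exp_poly. exp_eval f \<xi> = 0 \<longrightarrow>
           (\<exists>g :: exp_poly. \<forall>x. exp_eval h x \<noteq> 0 \<longrightarrow> exp_eval f x / exp_eval h x = exp_eval g x)"
proof (intro allI impI)
  fix f assume f0: "exp_eval f \<xi> = 0"
  interpret ev: comm_ring_hom_to_field "\<lambda>f. exp_eval f \<xi>" by unfold_locales (simp_all add: exp_eval_ring)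
  let ?B = "ep_const ` Qbar"
  have evB: "(\<lambda>f. exp_eval f \<xi>) ` ?B = Qbar"
    by (auto simp: image_image exp_eval_const Qbar_def)
  have injB: "inj_on (\<lambda>f. exp_eval f \<xi>) ?B"
    by (auto simp: inj_on_def exp_eval_const Qbar_def)
  obtain \<Gamma>1 where \<Gamma>1: "finite \<Gamma>1" "\<And>\<gamma>. \<gamma> \<in> \<Gamma>1 \<Longrightarrow> algebraic \<gamma>" "has_exponents f \<Gamma>1"
    by (rule has_exponents_obtain[of f]) blast
  obtain \<Gamma>2 where \<Gamma>2: "finite \<Gamma>2" "\<And>\<gamma>. \<gamma> \<in> \<Gamma>2 \<Longrightarrow> algebraic \<gamma>" "has_exponents h \<Gamma>2"
    by (rule has_exponents_obtain[of h]) blast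
  have fexp: "has_exponents f (\<Gamma>1 \<union> \<Gamma>2)" and hexp: "has_exponents h (\<Gamma>1 \<union> \<Gamma>2)"
    using \<Gamma>1(3) \<Gamma>2(3) by (auto elim: has_exponents_mono)
  have fin\<Gamma>: "finite (\<Gamma>1 \<union> \<Gamma>2)" and alg\<Gamma>: "\<And>\<gamma>. \<gamma> \<in> \<Gamma>1 \<union> \<Gamma>2 \<Longrightarrow> algebraic \<gamma>" using \<Gamma>1 \<Gamma>2 by auto
  obtain n :: nat and \<beta> where \<beta>: "inj_on \<beta> {1..n}" "rat_vs.independent (\<beta> ` {1..n})"
    "\<And>i. i \<in> {1..n} \<Longrightarrow> algebraic (\<beta> i)"
    "\<And>\<gamma>. \<gamma> \<in> \<Gamma>1 \<union> \<Gamma>2 \<Longrightarrow> \<exists>k :: nat \<Rightarrow> int. \<gamma> = (\<Sum>i=1..n. of_int (k i) * \<beta> i)"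
    by (rule integer_basis[OF fin\<Gamma> alg\<Gamma>], assumption) (rule that)
  obtain T where T: "T \<subseteq> insert \<xi> ((\<lambda>i. exp (\<beta> i * \<xi>)) ` {1..n})" "Qbar.indep T" "card T = n"
    by (rule schanuel_transcendence_basis[OF assms(1,2) \<beta>(1-3)])
  \<comment> \<open>Index 0 stands for the identity function and the indices 1 to n for the
    exponentials.\<close>
  define s where "s = (\<lambda>i. if i = 0 then ep_id else ep_exp (\<beta> i))"
  have "insert \<xi> ((\<lambda>i. exp (\<beta> i * \<xi>)) ` {1..n}) \<subseteq> (\<lambda>i. exp_eval (s i) \<xi>) ` {0..n}"
  proof -
    have "\<xi> = exp_eval (s 0) \<xi>" by (simp add: s_def exp_eval_id)
    moreover have "exp (\<beta> i * \<xi>) = exp_eval (s i) \<xi>" if "i \<in> {1..n}" for i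
      using that \<beta>(3) by (simp add: s_def exp_eval_exp)
    ultimately show ?thesis by fastforce
  qed
  then have "T \<subseteq> (\<lambda>i. exp_eval (s i) \<xi>) ` {0..n}" using T(1) by blast
  \<comment> \<open>Different indices could give the same value at \<open>\<xi>\<close>; choosing
    \<open>J\<close> injectively makes it have exactly n members and leaves exactly one index
    \<open>v\<close> in \<open>{0..n}\<close>.\<close>
  then obtain J where J: "J \<subseteq> {0..n}" "inj_on (\<lambda>i. exp_eval (s i) \<xi>) J" "T = (\<lambda>i. exp_eval (s i) \<xi>) ` J"
    unfolding subset_image_inj by blast
  have finJ: "finite J" using J(1) finite_subset by blast
  have "card J = n" using J(2,3) T(3) card_image by metis
  then have "card ({0..n} - J) = 1" using J(1) finJ by (simp add: card_Diff_subset)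
  then obtain v where v: "{0..n} - J = {v}" by (auto simp: card_1_singleton_iff)
  obtain js where js: "set js = J" "distinct js" using finite_distinct_list[OF finJ] by blast
  define ss where "ss = map s js"
  define R where "R = adjoin (gen ?B ss) (s v)"
  have "distinct (map (\<lambda>f. exp_eval f \<xi>) ss)" "set (map (\<lambda>f. exp_eval f \<xi>) ss) = T"
    using js J(2,3) by (auto simp: ss_def distinct_map inj_on_def)
  then have tl: "Qbar.transc_list (map (\<lambda>f. exp_eval f \<xi>) ss)"
    using T(2) Qbar.transc_list_if_indep by blast
  note G = is_subring_gen[OF is_subring_ep_const, of ss]
  have R: "is_subring R" unfolding R_def by (rule is_subring_adjoin[OF G])
  have genR: "gen ?B ss \<subseteq> R" "s v \<in> R"
    unfolding R_def using subset_adjoin[OF G] self_in_adjoin[OF G] by auto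
  have BR: "?B \<subseteq> R" using genR(1) gen_superset[OF is_subring_ep_const, of ss] by blast
  have sR: "s i \<in> R" if "i \<in> {0..n}" for i
  proof (cases "i \<in> J")
    case True
    then have "s i \<in> set ss" using js by (simp add: ss_def)
    then show ?thesis using genR(1) gen_superset[OF is_subring_ep_const, of ss] by blast
  next
    case False
    then have "i = v" using v that by blast
    then show ?thesis using genR(2) by simp
  qed
  have idR: "ep_id \<in> R" using sR[of 0] by (simp add: s_def)
  have expR: "ep_exp (\<beta> i) \<in> R" if "i \<in> {1..n}" for i using sR[of i] that by (simp add: s_def)
  obtain a where a: "algebraic a" "h * ep_exp a \<in> R"
    by (rule mult_exp_in_subring[OF R BR idR expR \<beta>(3,4) hexp])
  obtain b where b: "algebraic b" "f * ep_exp b \<in> R"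
    by (rule mult_exp_in_subring[OF R BR idR expR \<beta>(3,4) fexp])
  obtain a' where a': "1 = ep_exp a * a'" using ep_exp_dvd_one[OF a(1)] by (elim dvdE)
  obtain b' where b': "1 = ep_exp b * b'" using ep_exp_dvd_one[OF b(1)] by (elim dvdE)
  have h_eq: "h = (h * ep_exp a) * a'" using a' by (simp add: mult.assoc)
  have f_eq: "f = (f * ep_exp b) * b'" using b' by (simp add: mult.assoc)
  have "h \<noteq> 0" using assms(3) by auto
  then have "h * ep_exp a \<noteq> 0" using h_eq by auto
  then obtain g where g: "exp_eval g \<xi> = 0" "\<And>F. F \<in> R \<Longrightarrow> exp_eval F \<xi> = 0 \<Longrightarrow> g dvd F"
    using ev.kernel_principal[of ?B ss "h * ep_exp a" "s v"] is_subring_ep_const injB evB factorial_in_Qbar tl a(2) assms(4)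
    unfolding R_def by (auto simp: exp_eval_ring)
  have "g dvd h * ep_exp a" "g dvd f * ep_exp b"
    using g(2) a(2) b(2) assms(4) f0 by (auto simp: exp_eval_ring)
  then have gh: "g dvd h" and gf: "g dvd f" using h_eq f_eq by (metis dvd_mult2)+
  obtain q where q: "h = g * q" using gh by (elim dvdE)
  \<comment> \<open>A unit has no zeros, whereas \<open>g\<close> vanishes at
    \<open>\<xi>\<close>.\<close>
  have "\<not> g dvd 1"
  proof
    assume "g dvd 1"
    then obtain w where "1 = g * w" by (elim dvdE)
    then have "exp_eval (g * w) \<xi> = 1" by (metis exp_eval_ring(2))
    then show False using g(1) by (simp add: exp_eval_ring)
  qed
  then have "q dvd 1" using assms(3) q unfolding irreducible_def by blast
  then obtain w where w: "1 = q * w" by (elim dvdE)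
  have "g = h * w" using q w by (simp add: mult.assoc)
  then have "h dvd f" using gf by (metis dvd_mult_left)
  then obtain u where u: "f = h * u" by (elim dvdE)
  \<comment> \<open>The identity \<open>f = h * u\<close> holds at every point, so \<open>u\<close>
    also gives the values of the quotient at the zeros of \<open>h\<close>, where it has to be read
    as a continuation.\<close>
  show "\<exists>g. \<forall>x. exp_eval h x \<noteq> 0 \<longrightarrow> exp_eval f x / exp_eval h x = exp_eval g x"
    by (intro exI[of _ u]) (simp add: u exp_eval_ring)
qed

end
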